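(* Let $k\ge 6$ be an integer, let $T\subset\mathbb R^2$ be a closed axis-parallel square with vertices $\mathbf x_1$ (lower left), $\mathbf x_2$ (lower right), $\mathbf x_3$ (upper right), $\mathbf x_4$ (upper left), and let $$V_k(T)=\operatorname{span}\{P_k(T),\ b_5,b_6,b_7,b_8,b_{12},b_{14},b_{2_1},b_{2_2},b_{2_3},b_{2_4},b_{2_6},b_{3_2}\},$$ where the functions $b_i$ and $b_{i_j}$ are the elements of the dual basis of $Q_k(T)$ described in the context. Then the following degrees of freedom uniquely determine the functions in $V_k(T)$ (that is, for every choice of prescribed real values of these degrees of freedom there is exactly one $p\in V_k(T)$ attaining them): with $j'=k-2-j$, (1) $p(\mathbf x_i),\ \partial_x p(\mathbf x_i),\ \partial_y p(\mathbf x_i),\ \partial_{xy}p(\mathbf x_i)$, $i=1,2,3,4$; (2) $p\big(\tfrac{j\mathbf x_1+j'\mathbf x_2}{k-2}\big),\ \partial_y p\big(\tfrac{j\mathbf x_1+j'\mathbf x_2}{k-2}\big)$, $j=1,\dots,k-3$; (3) $p\big(\tfrac{j\mathbf x_2+j'\mathbf x_3}{k-2}\big),\ \partial_x p\big(\tfrac{j\mathbf x_2+j'\mathbf x_3}{k-2}\big)$, $j=1,\dots,k-3$; (4) $p\big(\tfrac{j\mathbf x_4+j'\mathbf x_3}{k-2}\big),\ \partial_y p\big(\tfrac{j\mathbf x_4+j'\mathbf x_3}{k-2}\big)$, $j=1,\dots,k-3$; (5) $p\big(\tfrac{j\mathbf x_1+j'\mathbf x_4}{k-2}\big),\ \partial_x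 p\big(\tfrac{j\mathbf x_1+j'\mathbf x_4}{k-2}\big)$, $j=1,\dots,k-3$; (6) if $k>7$: $p\big(\tfrac{i\mathbf x_2+j\mathbf x_4+(k-2-i-j)\mathbf x_1}{k-2}\big)$, $i=1,\dots,k-7$, $j=1,\dots,i$.
   Context: $P_k(T)$ is the space of real polynomials in $(x,y)$ of total degree at most $k$ on $T$; $Q_k(T)$ is the space of polynomials of degree at most $k$ in each variable separately. The $(k+1)^2$ degrees of freedom of the $C^1$-$Q_k$ Bogner-Fox-Schmit element on $T$ are arranged in six rows, with $j'=k-2-j$, $\ell'=k-2-\ell$: Row 1: for $i=1,2,3,4$ in turn, $p(\mathbf x_i),\partial_xp(\mathbf x_i),\partial_yp(\mathbf x_i),\partial_{xy}p(\mathbf x_i)$, numbered $4i-3,4i-2,4i-1,4i$ respectively. Row 2: for $j=1,\dots,k-3$ in turn, $p(\frac{j\mathbf x_1+j'\mathbf x_2}{k-2}),\ \partial_yp(\frac{j\mathbf x_1+j'\mathbf x_2}{k-2})$. Row 3: for $j=1,\dots,k-3$ in turn, $p(\frac{j\mathbf x_2+j'\mathbf x_3}{k-2}),\ \partial_xp(\frac{j\mathbf x_2+j'\mathbf x_3}{k-2})$. Row 4: for $j=1,\dots,k-3$ in turn, $p(\frac{j\mathbf x_4+j'\mathbf x_3}{k-2}),\ \partial_yp(\frac{j\mathbf x_4+j'\mathbf x_3}{k-2})$. Row 5: for $j=1,\dots,k-3$ in turn, $p(\frac{j\mathbf x_1+j'\mathbf x_4}{k-2}),\ \partial_xp(\frac{j\mathbf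 x_1+j'\mathbf x_4}{k-2})$. Row 6: $p\big(\frac{(j\mathbf x_1+j'\mathbf x_4)\ell+(j\mathbf x_2+j'\mathbf x_3)\ell'}{(k-2)^2}\big)$, $j,\ell=1,\dots,k-3$. These functionals are unisolvent on $Q_k(T)$; consider the basis of $Q_k(T)$ dual to them (each basis function has value 1 for its own degree of freedom and 0 for all others). For $1\le i\le 16$, $b_i$ is the dual basis function of the $i$-th degree of freedom of Row 1; $b_{i_j}$ is the dual basis function of the $j$-th degree of freedom in Row $i$. Thus $b_{2_1},b_{2_3}$ correspond to the values of $p$ at the Row 2 nodes $j=1,2$; $b_{2_2},b_{2_4},b_{2_6}$ to $\partial_yp$ at the Row 2 nodes $j=1,2,3$; and $b_{3_2}$ to $\partial_xp$ at the Row 3 node $j=1$. *)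

theory Defs
  imports "HOL-Analysis.Analysis" "HOL-Library.Function_Algebras"
begin

(* T is the closed axis-parallel square with vertices x 1, ..., x 4, listed
   counterclockwise from the lower left one. *)
definition square_vertices :: "(real \<times> real) set \<Rightarrow> (nat \<Rightarrow> real \<times> real) \<Rightarrow> bool" where
  "square_vertices T x \<longleftrightarrow>
     (\<exists>a b h. h > 0 \<and> T = cbox (a, b) (a + h, b + h) \<and>
        x 1 = (a, b) \<and> x 2 = (a + h, b) \<and> x 3 = (a + h, b + h) \<and> x 4 = (a, b + h))"

(* A polynomial on T is represented by the polynomial function on the whole plane.
   This loses nothing: T has interior points, so the function on T determines it. *)
type_synonym plane_fun = "real \<times> real \<Rightarrow> real"

definition fspan :: "plane_fun set \<Rightarrow> plane_fun set" where
  "fspan = module.span (\<lambda>(c::real) (p::plane_fun). (\<lambda>z. c * p z))"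

definition monomial :: "nat \<Rightarrow> nat \<Rightarrow> plane_fun" where
  "monomial m n = (\<lambda>(s, t). s ^ m * t ^ n)"

definition P_space :: "nat \<Rightarrow> plane_fun set" where
  "P_space k = fspan {monomial m n |m n. m + n \<le> k}"

definition Q_space :: "nat \<Rightarrow> plane_fun set" where
  "Q_space k = fspan {monomial m n |m n. m \<le> k \<and> n \<le> k}"

definition dx :: "plane_fun \<Rightarrow> plane_fun" where
  "dx p = (\<lambda>(s, t). deriv (\<lambda>u. p (u, t)) s)"

definition dy :: "plane_fun \<Rightarrow> plane_fun" where
  "dy p = (\<lambda>(s, t). deriv (\<lambda>u. p (s, u)) t)"

definition dxy :: "plane_fun \<Rightarrow> plane_fun" where
  "dxy p = dy (dx p)"

(* The point (j u + j' v) / (k - 2), where j' = k - 2 - j. *)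
definition edge_node :: "nat \<Rightarrow> real \<times> real \<Rightarrow> real \<times> real \<Rightarrow> nat \<Rightarrow> real \<times> real" where
  "edge_node k u v j =
     (1 / (real k - 2)) *\<^sub>R (real j *\<^sub>R u + (real k - 2 - real j) *\<^sub>R v)"

type_synonym dof = "plane_fun \<Rightarrow> real"

definition vertex_dofs :: "(nat \<Rightarrow> real \<times> real) \<Rightarrow> dof list" where
  "vertex_dofs x =
     concat (map (\<lambda>i. [\<lambda>p. p (x i), \<lambda>p. dx p (x i), \<lambda>p. dy p (x i), \<lambda>p. dxy p (x i)]) [1..<5])"

(* D is the derivative normal to the edge with end points u and v. *)
definition edge_dofs ::
  "nat \<Rightarrow> (plane_fun \<Rightarrow> plane_fun) \<Rightarrow> real \<times> real \<Rightarrow> real \<times> real \<Rightarrow> dof list" where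
  "edge_dofs k D u v =
     concat (map (\<lambda>j. [\<lambda>p. p (edge_node k u v j), \<lambda>p. D p (edge_node k u v j)]) [1..<k - 2])"

definition inner_node :: "nat \<Rightarrow> (nat \<Rightarrow> real \<times> real) \<Rightarrow> nat \<Rightarrow> nat \<Rightarrow> real \<times> real" where
  "inner_node k x j l =
     (let j' = real k - 2 - real j; l' = real k - 2 - real l in
      (1 / (real k - 2)\<^sup>2) *\<^sub>R
        (real l *\<^sub>R (real j *\<^sub>R x 1 + j' *\<^sub>R x 4) + l' *\<^sub>R (real j *\<^sub>R x 2 + j' *\<^sub>R x 3)))"

definition inner_dofs :: "nat \<Rightarrow> (nat \<Rightarrow> real \<times> real) \<Rightarrow> dof list" where
  "inner_dofs k x =
     concat (map (\<lambda>j. map (\<lambda>l p. p (inner_node k x j l)) [1..<k - 2]) [1..<k - 2])"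

(* The six rows of degrees of freedom of the Bogner-Fox-Schmit element. *)
definition bfs_row :: "nat \<Rightarrow> (nat \<Rightarrow> real \<times> real) \<Rightarrow> nat \<Rightarrow> dof list" where
  "bfs_row k x r =
     (if r = 1 then vertex_dofs x
      else if r = 2 then edge_dofs k dy (x 1) (x 2)
      else if r = 3 then edge_dofs k dx (x 2) (x 3)
      else if r = 4 then edge_dofs k dy (x 4) (x 3)
      else if r = 5 then edge_dofs k dx (x 1) (x 4)
      else if r = 6 then inner_dofs k x
      else [])"

(* The dual basis function of the n-th degree of freedom in row r; rows and positions
   are counted from 1, hence the shift in the list index. *)
definition bfs_basis :: "nat \<Rightarrow> (nat \<Rightarrow> real \<times> real) \<Rightarrow> nat \<Rightarrow> nat \<Rightarrow> plane_fun" where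
  "bfs_basis k x r n =
     (THE p. p \<in> Q_space k \<and>
        (\<forall>s\<in>{1..6}. \<forall>m\<in>{1..length (bfs_row k x s)}.
           (bfs_row k x s ! (m - 1)) p = (if s = r \<and> m = n then 1 else 0)))"

definition V_space :: "nat \<Rightarrow> (nat \<Rightarrow> real \<times> real) \<Rightarrow> plane_fun set" where
  "V_space k x =
     fspan (P_space k \<union> bfs_basis k x 1 ` {5, 6, 7, 8, 12, 14}
                      \<union> bfs_basis k x 2 ` {1, 2, 3, 4, 6}
                      \<union> bfs_basis k x 3 ` {2})"

(* The scalar k - 2 - i - j is a real number; it is negative for some i, j once k > 12. *)
definition serendipity_node :: "nat \<Rightarrow> (nat \<Rightarrow> real \<times> real) \<Rightarrow> nat \<Rightarrow> nat \<Rightarrow> real \<times> real" where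
  "serendipity_node k x i j =
     (1 / (real k - 2)) *\<^sub>R
       (real i *\<^sub>R x 2 + real j *\<^sub>R x 4 + (real k - 2 - real i - real j) *\<^sub>R x 1)"

definition serendipity_inner_dofs :: "nat \<Rightarrow> (nat \<Rightarrow> real \<times> real) \<Rightarrow> dof list" where
  "serendipity_inner_dofs k x =
     (if k > 7
      then concat (map (\<lambda>i. map (\<lambda>j p. p (serendipity_node k x i j)) [1..<Suc i]) [1..<k - 6])
      else [])"

definition V_dofs :: "nat \<Rightarrow> (nat \<Rightarrow> real \<times> real) \<Rightarrow> dof list" where
  "V_dofs k x =
     vertex_dofs x
     @ edge_dofs k dy (x 1) (x 2) @ edge_dofs k dx (x 2) (x 3)
     @ edge_dofs k dy (x 4) (x 3) @ edge_dofs k dx (x 1) (x 4)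
     @ serendipity_inner_dofs k x"

end

(* Counting dimensions, unisolvence reduces to injectivity of the degrees of freedom on coefficient
   vectors of the generators. Write the combination as p = q + r with q in P_k and r in the span of
   the twelve dual basis functions. All remaining boundary functionals vanish on r, hence on q, and
   since the total degree of q is at most k this already forces q = B g, where B is the squared
   product of the four edge equations and g has degree at most k - 8: go around the boundary left,
   top, right, bottom, splitting off each edge equation twice. Then the twelve functionals vanish on q
   as well, so r = 0, and the interior nodes form a triangular array that kills g. *)

theory Submission
  imports Defs
begin

subsection \<open>Square linear systems\<close>

text \<open>The number twelve is the surplus of boundary functionals. The eight linear factors of B
  are split off by means of traces with k + 1, k, ..., k - 6 coefficients, which uses 8 k - 20
  conditions, whereas the boundary carries 16 + 8 (k - 3) = 8 k - 8. All of these one-variable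
  problems but one are of Hermite type. At \<open>x 4\<close> the functional \<open>dx\<close> is
  free while \<open>dxy\<close> is prescribed, so the normal derivative on the left edge has a
  condition on its derivative alone; this Birkhoff problem is solvable because all other nodes lie
  on one side of \<open>x 4\<close>. The dual functions are introduced by a definite description, so
  the unisolvence of the full element on Q_k has to be proved as well. The same linear algebra
  serves both spaces.\<close>

lemma underdetermined_system:
  fixes A :: "'i \<Rightarrow> 'j \<Rightarrow> real"
  assumes "finite I" "finite J" "card I < card J"
  shows "\<exists>c. (\<exists>j\<in>J. c j \<noteq> 0) \<and> (\<forall>i\<in>I. (\<Sum>j\<in>J. c j * A i j) = 0)"
  using assms
proof (induction I arbitrary: J A rule: finite_induct)
  case empty
  then obtain j where "j \<in> J" by fastforce
  then show ?case by (intro exI[of _ "\<lambda>_. 1"]) auto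
next
  case (insert i0 I)
  show ?case
  proof (cases "\<forall>j\<in>J. A i0 j = 0")
    case True
    moreover obtain c where "\<exists>j\<in>J. c j \<noteq> 0" "\<forall>i\<in>I. (\<Sum>j\<in>J. c j * A i j) = 0"
      using insert.IH[of J A] insert.prems insert.hyps by auto
    ultimately show ?thesis by (intro exI[of _ c]) auto
  next
    case False
    then obtain j0 where j0: "j0 \<in> J" "A i0 j0 \<noteq> 0" by blast
    define J' where "J' = J - {j0}"
    \<comment> \<open>Gaussian elimination: equation \<open>i0\<close> is solved for the pivot
      unknown \<open>j0\<close>, and \<open>B\<close> is the system left for the other unknowns.
      Back substitution yields \<open>c'\<close>.\<close>
    define B where "B i j = A i j - A i j0 * A i0 j / A i0 j0" for i j
    have J': "finite J'" "j0 \<notin> J'" "J = insert j0 J'"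
      using j0 insert.prems by (auto simp: J'_def)
    have "card I < card J'"
      using insert.prems insert.hyps J' by auto
    then obtain c where c: "\<exists>j\<in>J'. c j \<noteq> 0" "\<forall>i\<in>I. (\<Sum>j\<in>J'. c j * B i j) = 0"
      using insert.IH[OF J'(1)] by blast
    define S where "S = (\<Sum>j\<in>J'. c j * A i0 j)"
    define c' where "c' = c(j0 := - S / A i0 j0)"
    have sum_c': "(\<Sum>j\<in>J. c' j * A i j) = (\<Sum>j\<in>J'. c j * A i j) - S * A i j0 / A i0 j0" for i
    proof -
      have "(\<Sum>j\<in>J'. c' j * A i j) = (\<Sum>j\<in>J'. c j * A i j)"
        using J'(2) by (intro sum.cong) (auto simp: c'_def)
      then show ?thesis
        using J' by (simp add: c'_def)
    qed
    have "(\<Sum>j\<in>J'. c j * B i j) = (\<Sum>j\<in>J'. c j * A i j) - S * A i j0 / A i0 j0" for i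
      by (simp add: B_def S_def right_diff_distrib sum_subtractf sum_distrib_right
          sum_distrib_left sum_divide_distrib mult_ac)
    then have "\<forall>i\<in>insert i0 I. (\<Sum>j\<in>J. c' j * A i j) = 0"
      using c(2) j0(2) by (simp add: sum_c' S_def)
    moreover have "\<exists>j\<in>J. c' j \<noteq> 0"
      using c(1) J' by (auto simp: c'_def)
    ultimately show ?thesis by blast
  qed
qed

text \<open>The right-hand side is adjoined as one more column, indexed by \<open>None\<close>; injectivity
  makes its coefficient in a nontrivial solution nonzero.\<close>

lemma square_system_solvable:
  fixes A :: "'i \<Rightarrow> 'j \<Rightarrow> real"
  assumes fin: "finite I" "finite J" and card: "card I = card J"
    and inj: "\<And>c. (\<And>i. i \<in> I \<Longrightarrow> (\<Sum>j\<in>J. c j * A i j) = 0) \<Longrightarrow> \<forall>j\<in>J. c j = 0"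
  shows "\<exists>c. \<forall>i\<in>I. (\<Sum>j\<in>J. c j * A i j) = d i"
proof -
  define J' where "J' = insert None (Some ` J)"
  define B where "B i j = (case j of None \<Rightarrow> - d i | Some j \<Rightarrow> A i j)" for i j
  have sum_J': "(\<Sum>j\<in>J'. c j * B i j) = (\<Sum>j\<in>J. c (Some j) * A i j) - c None * d i" for c i
    using fin(2) by (simp add: J'_def B_def sum.reindex)
  have "card I < card J'"
    using fin(2) card by (simp add: J'_def card_image)
  moreover have "finite J'"
    using fin(2) by (simp add: J'_def)
  ultimately obtain c where c: "\<exists>j\<in>J'. c j \<noteq> 0" "\<forall>i\<in>I. (\<Sum>j\<in>J'. c j * B i j) = 0"
    using underdetermined_system[OF fin(1)] by blast
  have eq: "(\<Sum>j\<in>J. c (Some j) * A i j) = c None * d i" if "i \<in> I" for i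
    using c(2) that by (auto simp: sum_J')
  have "c None \<noteq> 0"
  proof
    assume "c None = 0"
    with eq inj[of "\<lambda>j. c (Some j)"] c(1) show False
      by (auto simp: J'_def)
  qed
  have "(\<Sum>j\<in>J. c (Some j) / c None * A i j) = d i" if "i \<in> I" for i
  proof -
    have "(\<Sum>j\<in>J. c (Some j) / c None * A i j) = (\<Sum>j\<in>J. c (Some j) * A i j) / c None"
      by (simp add: sum_divide_distrib)
    with eq[OF that] \<open>c None \<noteq> 0\<close> show ?thesis by simp
  qed
  then show ?thesis
    by (intro exI[of _ "\<lambda>j. c (Some j) / c None"] ballI)
qed

subsection \<open>Spans of plane functions\<close>

text \<open>Scaling is an explicit term here, so the facts about \<open>fspan\<close> are obtained
  by instantiating the general theory of spans with this one.\<close>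

lemma module_plane_fun: "module (\<lambda>(c::real) (p::plane_fun). (\<lambda>z. c * p z))"
  by unfold_locales (simp_all add: fun_eq_iff plus_fun_def distrib_left distrib_right)

lemmas fspan_base = module.span_base[OF module_plane_fun, folded fspan_def]
  and fspan_zero = module.span_zero[OF module_plane_fun, folded fspan_def]
  and fspan_add = module.span_add[OF module_plane_fun, folded fspan_def]
  and fspan_scale = module.span_scale[OF module_plane_fun, folded fspan_def]
  and fspan_mono = module.span_mono[OF module_plane_fun, folded fspan_def]
  and fspan_minimal = module.span_minimal[OF module_plane_fun, folded fspan_def]
  and fspan_sum = module.span_sum[OF module_plane_fun, folded fspan_def]
  and subspace_fspan = module.subspace_span[OF module_plane_fun, folded fspan_def]

text \<open>The functions satisfying \<open>P\<close> form a subspace containing \<open>S\<close>.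
  The closure rules use pointwise lambda terms, the form in which sums and multiples occur
  below.\<close>

lemma fspan_induct [consumes 1, case_names zero add scale base]:
  assumes "f \<in> fspan S"
    and "P (\<lambda>_. 0)"
    and "\<And>f g. P f \<Longrightarrow> P g \<Longrightarrow> P (\<lambda>z. f z + g z)"
    and "\<And>c f. P f \<Longrightarrow> P (\<lambda>z. c * f z)"
    and "\<And>f. f \<in> S \<Longrightarrow> P f"
  shows "P f"
proof -
  have "module.subspace (\<lambda>(c::real) (p::plane_fun). (\<lambda>z. c * p z)) {f. P f}"
    using assms(2-4)
    by (auto simp: module.subspace_def[OF module_plane_fun] zero_fun_def plus_fun_def)
  then have "fspan S \<subseteq> {f. P f}"
    using assms(5) by (intro fspan_minimal) auto
  with assms(1) show ?thesis by auto
qed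

lemma fspan_lincomb:
  assumes "\<And>j. j \<in> J \<Longrightarrow> g j \<in> fspan S"
  shows "(\<lambda>z. \<Sum>j\<in>J. c j * g j z) \<in> fspan S"
proof -
  have "(\<Sum>j\<in>J. (\<lambda>z. c j * g j z)) \<in> fspan S"
    by (intro fspan_sum fspan_scale assms)
  also have "(\<Sum>j\<in>J. (\<lambda>z. c j * g j z)) = (\<lambda>z. \<Sum>j\<in>J. c j * g j z)"
    by (induction J rule: infinite_finite_induct) (auto simp: fun_eq_iff)
  finally show ?thesis .
qed

text \<open>Coefficients are attached to indices and not to functions, so \<open>g\<close> may take
  a value twice.\<close>

lemma fspan_image_eq:
  assumes "finite J"
  shows "fspan (g ` J) = range (\<lambda>c z. \<Sum>j\<in>J. c j * g j z)"
proof (intro equalityI subsetI)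
  fix f assume "f \<in> fspan (g ` J)"
  then show "f \<in> range (\<lambda>c z. \<Sum>j\<in>J. c j * g j z)"
  proof (induction rule: fspan_induct)
    case zero
    show ?case by (intro image_eqI[of _ _ "\<lambda>_. 0"]) auto
  next
    case (add f1 f2)
    then obtain c d where "f1 = (\<lambda>z. \<Sum>j\<in>J. c j * g j z)" "f2 = (\<lambda>z. \<Sum>j\<in>J. d j * g j z)"
      by auto
    then show ?case
      by (intro image_eqI[of _ _ "\<lambda>j. c j + d j"]) (auto simp: algebra_simps sum.distrib)
  next
    case (scale a f1)
    then obtain c where "f1 = (\<lambda>z. \<Sum>j\<in>J. c j * g j z)" by auto
    then show ?case
      by (intro image_eqI[of _ _ "\<lambda>j. a * c j"]) (auto simp: algebra_simps sum_distrib_left)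
  next
    case (base f1)
    then obtain i where i: "i \<in> J" "f1 = g i" by auto
    show ?case
    proof (rule image_eqI[of _ _ "\<lambda>j. if j = i then 1 else 0"])
      show "f1 = (\<lambda>z. \<Sum>j\<in>J. (if j = i then 1 else 0) * g j z)"
        using i assms by (simp add: if_distrib[of "\<lambda>c. c * _"] cong: if_cong)
    qed simp
  qed
qed (auto intro!: fspan_lincomb intro: fspan_base)

text \<open>Linearity is relative to a set because \<open>deriv\<close> is additive only where the
  derivatives exist; the derivative functionals are not linear on all plane functions.\<close>

definition linear_dof_on :: "plane_fun set \<Rightarrow> dof \<Rightarrow> bool" where
  "linear_dof_on W \<phi> \<longleftrightarrow>
     (\<forall>p\<in>W. \<forall>q\<in>W. \<phi> (\<lambda>z. p z + q z) = \<phi> p + \<phi> q) \<and> (\<forall>c. \<forall>p\<in>W. \<phi> (\<lambda>z. c * p z) = c * \<phi> p)"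

lemma linear_dof_onI:
  assumes "\<And>p q. p \<in> W \<Longrightarrow> q \<in> W \<Longrightarrow> \<phi> (\<lambda>z. p z + q z) = \<phi> p + \<phi> q"
    and "\<And>c p. p \<in> W \<Longrightarrow> \<phi> (\<lambda>z. c * p z) = c * \<phi> p"
  shows "linear_dof_on W \<phi>"
  unfolding linear_dof_on_def using assms by blast

lemma linear_dof_on_add:
  "linear_dof_on W \<phi> \<Longrightarrow> p \<in> W \<Longrightarrow> q \<in> W \<Longrightarrow> \<phi> (\<lambda>z. p z + q z) = \<phi> p + \<phi> q"
  unfolding linear_dof_on_def by blast

lemma linear_dof_on_scale:
  "linear_dof_on W \<phi> \<Longrightarrow> p \<in> W \<Longrightarrow> \<phi> (\<lambda>z. c * p z) = c * \<phi> p"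
  unfolding linear_dof_on_def by blast

lemma linear_dof_on_lincomb:
  assumes lin: "linear_dof_on (fspan S) \<phi>" and g: "\<And>j. j \<in> J \<Longrightarrow> g j \<in> fspan S"
  shows "\<phi> (\<lambda>z. \<Sum>j\<in>J. c j * g j z) = (\<Sum>j\<in>J. c j * \<phi> (g j))"
proof -
  have zero: "\<phi> (\<lambda>z. 0) = 0"
    using linear_dof_on_scale[OF lin fspan_zero, of 0] by simp
  show ?thesis
    using g
  proof (induction J rule: infinite_finite_induct)
    case (insert i J)
    have "\<phi> (\<lambda>z. \<Sum>j\<in>insert i J. c j * g j z) = \<phi> (\<lambda>z. c i * g i z + (\<Sum>j\<in>J. c j * g j z))"
      using insert by simp
    also have "\<dots> = \<phi> (\<lambda>z. c i * g i z) + \<phi> (\<lambda>z. \<Sum>j\<in>J. c j * g j z)"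
      by (intro linear_dof_on_add[OF lin] fspan_scale fspan_lincomb insert.prems) auto
    also have "\<dots> = (\<Sum>j\<in>insert i J. c j * \<phi> (g j))"
      using insert by (simp add: linear_dof_on_scale[OF lin])
    finally show ?case .
  qed (auto simp: zero)
qed

text \<open>Hypothesis \<open>inj\<close> speaks of coefficient vectors, so it contains the
  independence of the generators, and counting indices replaces counting dimensions. The set
  \<open>S\<close> spans an ambient space on which the functionals are linear.\<close>

lemma unisolvent_fspan:
  assumes fin: "finite I" "finite J" and card: "card I = card J"
    and gen: "\<And>j. j \<in> J \<Longrightarrow> g j \<in> fspan S"
    and lin: "\<And>i. i \<in> I \<Longrightarrow> linear_dof_on (fspan S) (\<phi> i)"
    and inj: "\<And>c. (\<And>i. i \<in> I \<Longrightarrow> \<phi> i (\<lambda>z. \<Sum>j\<in>J. c j * g j z) = 0) \<Longrightarrow> \<forall>j\<in>J. c j = 0"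
  shows "\<exists>!p. p \<in> fspan (g ` J) \<and> (\<forall>i\<in>I. \<phi> i p = d i)"
proof -
  have lincomb: "\<phi> i (\<lambda>z. \<Sum>j\<in>J. c j * g j z) = (\<Sum>j\<in>J. c j * \<phi> i (g j))"
    if "i \<in> I" for i c
    using that by (intro linear_dof_on_lincomb[OF lin gen]) auto
  have "\<forall>j\<in>J. c j = 0"
    if "\<And>i. i \<in> I \<Longrightarrow> (\<Sum>j\<in>J. c j * \<phi> i (g j)) = 0" for c
    using that by (intro inj) (simp only: lincomb)
  then obtain c where c: "\<forall>i\<in>I. (\<Sum>j\<in>J. c j * \<phi> i (g j)) = d i"
    using square_system_solvable[of I J "\<lambda>i j. \<phi> i (g j)" d] fin card by auto
  show ?thesis
  proof (rule ex1I[of _ "\<lambda>z. \<Sum>j\<in>J. c j * g j z"])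
    show "(\<lambda>z. \<Sum>j\<in>J. c j * g j z) \<in> fspan (g ` J) \<and>
        (\<forall>i\<in>I. \<phi> i (\<lambda>z. \<Sum>j\<in>J. c j * g j z) = d i)"
      using c by (auto simp: lincomb fspan_image_eq[OF fin(2)])
  next
    fix p assume p: "p \<in> fspan (g ` J) \<and> (\<forall>i\<in>I. \<phi> i p = d i)"
    then obtain c' where c': "p = (\<lambda>z. \<Sum>j\<in>J. c' j * g j z)"
      by (auto simp: fspan_image_eq[OF fin(2)])
    have "\<forall>j\<in>J. c' j - c j = 0"
    proof (rule inj)
      fix i assume i: "i \<in> I"
      have "\<phi> i (\<lambda>z. \<Sum>j\<in>J. (c' j - c j) * g j z) = (\<Sum>j\<in>J. (c' j - c j) * \<phi> i (g j))"
        by (rule lincomb[OF i])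
      also have "\<dots> = (\<Sum>j\<in>J. c' j * \<phi> i (g j)) - (\<Sum>j\<in>J. c j * \<phi> i (g j))"
        by (simp only: left_diff_distrib sum_subtractf)
      also have "(\<Sum>j\<in>J. c' j * \<phi> i (g j)) = d i"
        using p i unfolding c' lincomb[OF i, symmetric] by blast
      also have "(\<Sum>j\<in>J. c j * \<phi> i (g j)) = d i"
        using c i by blast
      finally show "\<phi> i (\<lambda>z. \<Sum>j\<in>J. (c' j - c j) * g j z) = 0"
        by simp
    qed
    then have eq: "c' j = c j" if "j \<in> J" for j
      using that by simp
    show "p = (\<lambda>z. \<Sum>j\<in>J. c j * g j z)"
      unfolding c' by (intro ext sum.cong refl) (simp only: eq)
  qed
qed

subsection \<open>Univariate interpolation\<close>

text \<open>The index counts coefficients, so that \<open>d = 0\<close> gives the zero function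
  alone; a bound on \<open>degree\<close> could not express this case.\<close>

definition poly_funs :: "nat \<Rightarrow> (real \<Rightarrow> real) set" where
  "poly_funs d = {poly q |q. \<forall>i\<ge>d. coeff q i = 0}"

lemma poly_funsI: "\<lbrakk>\<And>t. u t = poly q t; \<And>i. i \<ge> d \<Longrightarrow> coeff q i = 0\<rbrakk> \<Longrightarrow> u \<in> poly_funs d"
  unfolding poly_funs_def by blast

lemma poly_funsE:
  assumes "u \<in> poly_funs d"
  obtains q where "u = poly q" "\<And>i. i \<ge> d \<Longrightarrow> coeff q i = 0"
  using assms unfolding poly_funs_def by blast

lemma poly_funs_zero: "(\<lambda>_. 0) \<in> poly_funs d"
  by (rule poly_funsI[of _ 0]) simp_all

lemma poly_funs_add:
  assumes "u \<in> poly_funs d" "v \<in> poly_funs d"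
  shows "(\<lambda>t. u t + v t) \<in> poly_funs d"
proof -
  from assms(1) obtain p where p: "u = poly p" "\<And>i. i \<ge> d \<Longrightarrow> coeff p i = 0"
    by (rule poly_funsE) blast
  from assms(2) obtain q where q: "v = poly q" "\<And>i. i \<ge> d \<Longrightarrow> coeff q i = 0"
    by (rule poly_funsE) blast
  show ?thesis
    by (rule poly_funsI[of _ "p + q"]) (simp_all add: p q)
qed

lemma poly_funs_scale:
  assumes "u \<in> poly_funs d"
  shows "(\<lambda>t. c * u t) \<in> poly_funs d"
proof -
  from assms obtain p where p: "u = poly p" "\<And>i. i \<ge> d \<Longrightarrow> coeff p i = 0"
    by (rule poly_funsE) blast
  show ?thesis
    by (rule poly_funsI[of _ "smult c p"]) (simp_all add: p)
qed

lemma poly_funs_power: "n < d \<Longrightarrow> (\<lambda>t. t ^ n) \<in> poly_funs d"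
  by (rule poly_funsI[of _ "monom 1 n"]) (simp_all add: poly_monom)

lemma poly_funs_differentiable: "u \<in> poly_funs d \<Longrightarrow> u field_differentiable (at t)"
proof -
  assume "u \<in> poly_funs d"
  then obtain q where q: "u = poly q" by (rule poly_funsE)
  show "u field_differentiable (at t)"
    unfolding q field_differentiable_def by (rule exI, rule poly_DERIV)
qed

lemma poly_funs_DERIV: "u \<in> poly_funs d \<Longrightarrow> (u has_real_derivative deriv u t) (at t)"
  using poly_funs_differentiable[of u d t] by (simp add: DERIV_deriv_iff_field_differentiable)

lemma poly_funs_isCont: "u \<in> poly_funs d \<Longrightarrow> isCont u t"
  by (rule DERIV_isCont[OF poly_funs_DERIV])

section \<open>Multiple roots and Hermite interpolation\<close>

lemma deriv_poly: "deriv (poly q) t = poly (pderiv q) t"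
  for q :: "real poly"
  by (rule DERIV_imp_deriv) (rule poly_DERIV)

text \<open>The derivative of (X - r) s at r is s(r), so a second factor X - r splits off.\<close>

lemma order_ge_2:
  fixes q :: "real poly"
  assumes "q \<noteq> 0" "poly q r = 0" "poly (pderiv q) r = 0"
  shows "2 \<le> order r q"
proof -
  obtain s where s: "q = [:-r, 1:] * s"
    using assms(2) by (auto simp: poly_eq_0_iff_dvd)
  have "poly s r = 0"
    using assms(3) by (simp add: s pderiv_mult pderiv_pCons del: mult_pCons_left)
  then obtain s' where "s = [:-r, 1:] * s'"
    by (auto simp: poly_eq_0_iff_dvd)
  with s have "q = [:-r, 1:] ^ 2 * s'"
    by (simp only: power2_eq_square mult.assoc)
  then have "[:-r, 1:] ^ 2 dvd q"
    by (rule dvdI)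
  with assms(1) show ?thesis
    using order_divides by blast
qed

text \<open>Roots are counted with multiplicity: a point of \<open>A\<close> contributes at least
  one, a point of \<open>B\<close> at least two, and a nonzero polynomial with \<open>d\<close>
  coefficients has degree below \<open>d\<close>.\<close>

lemma poly_Hermite_zero:
  fixes q :: "real poly"
  assumes deg: "\<forall>i\<ge>d. coeff q i = 0"
    and fin: "finite A" "finite B" and disj: "A \<inter> B = {}"
    and A: "\<And>r. r \<in> A \<Longrightarrow> poly q r = 0"
    and B: "\<And>r. r \<in> B \<Longrightarrow> poly q r = 0" "\<And>r. r \<in> B \<Longrightarrow> poly (pderiv q) r = 0"
    and card: "d \<le> card A + 2 * card B"
  shows "q = 0"
proof (rule ccontr)
  assume nz: "q \<noteq> 0"
  have "card A + 2 * card B = (\<Sum>r\<in>A. 1) + (\<Sum>r\<in>B. 2)"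
    by simp
  also have "\<dots> \<le> (\<Sum>r\<in>A. order r q) + (\<Sum>r\<in>B. order r q)"
    using nz A B order_ge_2[of q] 
    by (intro add_mono sum_mono) (auto simp: order_root Suc_le_eq)
  also have "\<dots> = (\<Sum>r\<in>A \<union> B. order r q)"
    using fin disj by (simp add: sum.union_disjoint)
  also have "\<dots> \<le> (\<Sum>r | poly q r = 0. order r q)"
    using nz A B by (intro sum_mono2) (auto simp: poly_roots_finite)
  also have "\<dots> \<le> degree q"
    using nz by (rule sum_order_le_degree)
  also have "degree q < d"
    using deg nz by (metis leading_coeff_0_iff not_le)
  finally show False using card by simp
qed

lemma poly_funs_Hermite_zero:
  assumes "u \<in> poly_funs d" "finite A" "finite B" "A \<inter> B = {}"
    and "\<And>r. r \<in> A \<Longrightarrow> u r = 0" "\<And>r. r \<in> B \<Longrightarrow> u r = 0" "\<And>r. r \<in> B \<Longrightarrow> deriv u r = 0"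
    and "d \<le> card A + 2 * card B"
  shows "u t = 0"
proof -
  obtain q where q: "u = poly q" "\<forall>i\<ge>d. coeff q i = 0"
    using poly_funsE[OF assms(1)] by metis
  have "q = 0"
    using assms(5-7) by (intro poly_Hermite_zero[OF q(2) assms(2-4) _ _ _ assms(8)])
      (simp_all add: q(1) deriv_poly)
  with q show ?thesis by simp
qed

lemmas poly_funs_zero_by_roots = poly_funs_Hermite_zero[of _ _ _ "{}", simplified]

text \<open>To the right of all roots each factor is positive with derivative one, so the product
  rule adds positive terms. Value and derivative must go through the induction together.\<close>

lemma prod_list_linear_factors_pos:
  fixes T :: real
  assumes "\<forall>r\<in>set rs. r < T" "rs \<noteq> []"
  defines "g \<equiv> prod_list (map (\<lambda>r. [:-r, 1:]) rs)"
  shows "poly g T > 0 \<and> poly (pderiv g) T > 0"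
  using assms(1,2) unfolding g_def
proof (induction rs)
  case (Cons r rs)
  then show ?case
    by (cases "rs = []")
      (auto simp: pderiv_mult pderiv_pCons simp del: mult_pCons_left
        intro!: add_pos_pos mult_pos_pos)
qed simp

lemma monic_prod_list_linear_factors:
  fixes rs :: "real list"
  defines "g \<equiv> prod_list (map (\<lambda>r. [:-r, 1:]) rs)"
  shows "degree g = length rs" "coeff g (length rs) = 1"
proof -
  have "degree g = length rs \<and> lead_coeff g = 1"
    unfolding g_def
  proof (induction rs)
    case (Cons r rs)
    then have "prod_list (map (\<lambda>r. [:-r, 1:]) rs) \<noteq> 0" by auto
    with Cons show ?case
      using lead_coeff_mult[of "[:-r, 1:]" "prod_list (map (\<lambda>r. [:-r, 1:]) rs)"]
      by (auto simp: degree_mult_eq simp del: mult_pCons_left)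
  qed simp
  then show "degree g = length rs" "coeff g (length rs) = 1" by auto
qed

text \<open>Birkhoff interpolation, with only the derivative prescribed at the right end point, is
  unisolvent here because a polynomial with all its roots to the left of
  \<open>T\<close> has a nonzero derivative at \<open>T\<close>.\<close>

lemma poly_funs_Birkhoff_zero:
  assumes u: "u \<in> poly_funs d" and A: "finite A" "\<And>r. r \<in> A \<Longrightarrow> u r = 0"
    and b: "b \<notin> A" "u b = 0" "deriv u b = 0"
    and T: "deriv u T = 0" "b < T" "\<And>r. r \<in> A \<Longrightarrow> r < T"
    and card: "d \<le> card A + 3"
  shows "u t = 0"
proof -
  obtain q where q: "u = poly q" "\<forall>i\<ge>d. coeff q i = 0"
    using poly_funsE[OF u] by metis
  obtain as where as: "set as = A" "distinct as"
    using finite_distinct_list[OF A(1)] by blast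
  have len: "length as = card A"
    using as distinct_card by fastforce
  define g where "g = prod_list (map (\<lambda>r. [:-r, 1:]) (b # b # as))"
  have g: "degree g = card A + 2" "coeff g (card A + 2) = 1"
    using monic_prod_list_linear_factors[of "b # b # as"] len by (simp_all add: g_def)
  have gT: "poly (pderiv g) T > 0"
    using prod_list_linear_factors_pos[of "b # b # as" T] T(2,3) as by (simp add: g_def)
  have gA: "poly g r = 0" if "r \<in> A" for r
  proof -
    have "[:-r, 1:] dvd g"
      unfolding g_def using that as(1) by (intro prod_list_dvd) auto
    then show ?thesis by (simp add: poly_eq_0_iff_dvd)
  qed
  have gb: "poly g b = 0" "poly (pderiv g) b = 0"
    by (simp_all add: g_def pderiv_mult pderiv_pCons del: mult_pCons_left)
  \<comment> \<open>Subtracting \<open>c\<close> times the monic \<open>g\<close> cancels the top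
    coefficient. The remaining \<open>card A + 2\<close> coefficients face as many Hermite
    conditions, simple on \<open>A\<close> and double at \<open>b\<close>.\<close>
  define c where "c = coeff q (card A + 2)"
  have "q - smult c g = 0"
  proof (rule poly_Hermite_zero[where d = "card A + 2" and A = A and B = "{b}"])
    show "\<forall>i\<ge>card A + 2. coeff (q - smult c g) i = 0"
    proof (intro allI impI)
      fix i assume i: "card A + 2 \<le> i"
      show "coeff (q - smult c g) i = 0"
      proof (cases "i = card A + 2")
        case True
        then show ?thesis using g by (simp add: c_def)
      next
        case False
        with i have "coeff g i = 0" by (intro coeff_eq_0) (simp add: g)
        moreover have "coeff q i = 0" using q(2) card i False by simp
        ultimately show ?thesis by simp
      qed
    qed
  qed (use A b gA gb in \<open>auto simp: q(1) deriv_poly pderiv_diff pderiv_smult\<close>)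
  then have qg: "q = smult c g" by simp
  then have "c * poly (pderiv g) T = 0"
    using T(1) by (simp add: q(1) deriv_poly pderiv_smult)
  with gT have "c = 0" by simp
  with qg q(1) show ?thesis by simp
qed

subsection \<open>Bivariate polynomials\<close>

text \<open>With a strict bound, \<open>total_below 0\<close> is the zero space. The truncated
  differences \<open>k - 6\<close> and \<open>k - 7\<close> therefore need no separate treatment for
  k = 6 and k = 7.\<close>

definition total_below :: "nat \<Rightarrow> plane_fun set" where
  "total_below d = fspan {monomial m n |m n. m + n < d}"

definition partial_below :: "nat \<Rightarrow> nat \<Rightarrow> plane_fun set" where
  "partial_below d e = fspan {monomial m n |m n. m < d \<and> n < e}"

lemma P_space_eq: "P_space k = total_below (Suc k)"
  by (simp add: P_space_def total_below_def less_Suc_eq_le)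

lemma Q_space_eq: "Q_space k = partial_below (Suc k) (Suc k)"
  by (simp add: Q_space_def partial_below_def less_Suc_eq_le)

lemma total_below_subset: "total_below d \<subseteq> partial_below d d"
  unfolding total_below_def partial_below_def
proof (rule fspan_mono, clarify)
  fix m n assume "m + n < d"
  then show "\<exists>m' n'. monomial m n = monomial m' n' \<and> m' < d \<and> n' < d"
    by (intro exI[of _ m] exI[of _ n]) simp
qed

lemma monomial_in_total_below: "m + n < d \<Longrightarrow> monomial m n \<in> total_below d"
  unfolding total_below_def by (rule fspan_base) blast

lemma monomial_in_partial_below: "m < d \<Longrightarrow> n < e \<Longrightarrow> monomial m n \<in> partial_below d e"
  unfolding partial_below_def by (rule fspan_base) blast

lemma total_below_0: "f \<in> total_below 0 \<Longrightarrow> f z = 0"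
  unfolding total_below_def by (induction rule: fspan_induct) auto

lemma poly_funs_slice_y:
  assumes "f \<in> partial_below d e"
  shows "(\<lambda>t. f (s, t)) \<in> poly_funs e"
  using assms unfolding partial_below_def
proof (induction rule: fspan_induct)
  case (base f)
  then obtain m n where f: "f = monomial m n" "n < e" by blast
  show ?case
    unfolding f(1) monomial_def case_prod_conv by (rule poly_funs_scale[OF poly_funs_power[OF f(2)]])
qed (simp_all only: poly_funs_zero poly_funs_add poly_funs_scale)

lemma poly_funs_slice_x:
  assumes "f \<in> partial_below d e"
  shows "(\<lambda>s. f (s, t)) \<in> poly_funs d"
  using assms unfolding partial_below_def
proof (induction rule: fspan_induct)
  case (base f)
  then obtain m n where f: "f = monomial m n" "m < d" by blast
  show ?case
    using poly_funs_scale[OF poly_funs_power[OF f(2)], of "t ^ n"]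
    by (simp add: f(1) monomial_def mult.commute)
qed (simp_all only: poly_funs_zero poly_funs_add poly_funs_scale)

section \<open>Partial derivatives as linear maps and functionals\<close>

lemma dx_add:
  assumes "f \<in> partial_below d e" "g \<in> partial_below d e"
  shows "dx (\<lambda>z. f z + g z) = (\<lambda>z. dx f z + dx g z)"
proof (rule ext, clarify)
  fix s t
  show "dx (\<lambda>z. f z + g z) (s, t) = dx f (s, t) + dx g (s, t)"
    unfolding dx_def case_prod_conv
    by (intro DERIV_imp_deriv DERIV_add poly_funs_DERIV[OF poly_funs_slice_x[OF assms(1)]]
        poly_funs_DERIV[OF poly_funs_slice_x[OF assms(2)]])
qed

lemma dx_scale:
  assumes "f \<in> partial_below d e"
  shows "dx (\<lambda>z. c * f z) = (\<lambda>z. c * dx f z)"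
proof (rule ext, clarify)
  fix s t
  show "dx (\<lambda>z. c * f z) (s, t) = c * dx f (s, t)"
    unfolding dx_def case_prod_conv
    by (intro DERIV_imp_deriv DERIV_cmult poly_funs_DERIV[OF poly_funs_slice_x[OF assms]])
qed

lemma dy_add:
  assumes "f \<in> partial_below d e" "g \<in> partial_below d e"
  shows "dy (\<lambda>z. f z + g z) = (\<lambda>z. dy f z + dy g z)"
proof (rule ext, clarify)
  fix s t
  show "dy (\<lambda>z. f z + g z) (s, t) = dy f (s, t) + dy g (s, t)"
    unfolding dy_def case_prod_conv
    by (intro DERIV_imp_deriv DERIV_add poly_funs_DERIV[OF poly_funs_slice_y[OF assms(1)]]
        poly_funs_DERIV[OF poly_funs_slice_y[OF assms(2)]])
qed

lemma dy_scale:
  assumes "f \<in> partial_below d e"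
  shows "dy (\<lambda>z. c * f z) = (\<lambda>z. c * dy f z)"
proof (rule ext, clarify)
  fix s t
  show "dy (\<lambda>z. c * f z) (s, t) = c * dy f (s, t)"
    unfolding dy_def case_prod_conv
    by (intro DERIV_imp_deriv DERIV_cmult poly_funs_DERIV[OF poly_funs_slice_y[OF assms]])
qed

lemma dx_in_partial_below:
  assumes "f \<in> partial_below d e"
  shows "dx f \<in> partial_below d e"
proof -
  \<comment> \<open>Membership of \<open>f\<close> itself is carried along, since
    \<open>dx_add\<close> and \<open>dx_scale\<close> apply only to polynomials.\<close>
  have "f \<in> partial_below d e \<and> dx f \<in> partial_below d e"
    using assms
    unfolding partial_below_def
  proof (induction rule: fspan_induct)
    case zero
    have "dx (\<lambda>_. 0) = (\<lambda>_. 0)" by (auto simp: dx_def)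
    then show ?case using fspan_zero by (simp add: zero_fun_def)
  next
    case (add f g)
    then show ?case
      using dx_add[of f d e g] fspan_add[of "dx f" _ "dx g"] fspan_add[of f _ g]
      by (simp add: partial_below_def plus_fun_def)
  next
    case (scale c f)
    then show ?case
      using dx_scale[of f d e c] fspan_scale[of "dx f" _ c] fspan_scale[of f _ c]
      by (simp add: partial_below_def)
  next
    case (base f)
    then obtain m n where f: "f = monomial m n" "m < d" "n < e" by blast
    have "dx f = (\<lambda>z. real m * monomial (m - 1) n z)"
    proof (rule ext, clarify)
      fix s t :: real
      have "((\<lambda>u. u ^ m * t ^ n) has_real_derivative real m * (s ^ (m - 1) * t ^ n)) (at s)"
        by (auto intro!: derivative_eq_intros)
      then show "dx f (s, t) = real m * monomial (m - 1) n (s, t)"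
        unfolding f(1) dx_def monomial_def case_prod_conv by (rule DERIV_imp_deriv)
    qed
    moreover have "monomial (m - 1) n \<in> partial_below d e"
      using f by (intro monomial_in_partial_below) auto
    ultimately show ?case
      using base fspan_scale fspan_base by (auto simp: partial_below_def)
  qed
  then show ?thesis ..
qed

lemma linear_dof_value: "linear_dof_on W (\<lambda>p. p z)"
  by (rule linear_dof_onI) (rule refl)+

lemma linear_dof_dx: "linear_dof_on (partial_below d e) (\<lambda>p. dx p z)"
  by (rule linear_dof_onI) (simp_all only: dx_add[of _ d e] dx_scale[of _ d e])

lemma linear_dof_dy: "linear_dof_on (partial_below d e) (\<lambda>p. dy p z)"
  by (rule linear_dof_onI) (simp_all only: dy_add[of _ d e] dy_scale[of _ d e])

lemma linear_dof_dxy: "linear_dof_on (partial_below d e) (\<lambda>p. dxy p z)"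
  unfolding dxy_def
  by (rule linear_dof_onI)
    (simp_all only: dx_add[of _ d e] dx_scale[of _ d e] dy_add[of _ d e] dy_scale[of _ d e]
      dx_in_partial_below)

lemma dx_eq_deriv_slice: "dx f (s, t) = deriv (\<lambda>u. f (u, t)) s"
  by (simp add: dx_def)

lemma dy_eq_deriv_slice: "dy f (s, t) = deriv (\<lambda>u. f (s, u)) t"
  by (simp add: dy_def)

lemma dxy_eq_deriv_slice: "dxy f (s, t) = deriv (\<lambda>u. dx f (s, u)) t"
  by (simp add: dxy_def dy_def)

section \<open>Division by linear factors\<close>

lemma total_below_swap:
  assumes "f \<in> total_below d"
  shows "f \<circ> prod.swap \<in> total_below d"
  using assms unfolding total_below_def
proof (induction rule: fspan_induct)
  case zero
  then show ?case using fspan_zero by (simp add: zero_fun_def o_def)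
next
  case (add f g)
  then show ?case using fspan_add[OF add.IH] by (simp add: plus_fun_def o_def)
next
  case (scale c f)
  then show ?case using fspan_scale[OF scale.IH] by (simp add: o_def)
next
  case (base f)
  then obtain m n where f: "f = monomial m n" "m + n < d" by blast
  then have "f \<circ> prod.swap = monomial n m" by (auto simp: monomial_def)
  then show ?case using f monomial_in_total_below[of n m d] by (simp add: total_below_def)
qed

text \<open>Division by s - a with remainder the trace on the line s = a. Keeping the remainder
  makes the claim stable under linear combinations; on monomials it is the geometric factorisation
  of s^m - a^m.\<close>

lemma total_below_divide_x:
  assumes "f \<in> total_below d"
  shows "\<exists>g\<in>total_below (d - 1). \<forall>s t. f (s, t) = f (a, t) + (s - a) * g (s, t)"
  using assms unfolding total_below_def
proof (induction rule: fspan_induct)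
  case zero
  show ?case using fspan_zero by (intro bexI[of _ "\<lambda>_. 0"]) (auto simp: zero_fun_def)
next
  case (add f1 f2)
  then obtain g1 g2 where g: "g1 \<in> fspan {monomial m n |m n. m + n < d - 1}"
    "g2 \<in> fspan {monomial m n |m n. m + n < d - 1}"
    "\<forall>s t. f1 (s, t) = f1 (a, t) + (s - a) * g1 (s, t)"
    "\<forall>s t. f2 (s, t) = f2 (a, t) + (s - a) * g2 (s, t)" by blast
  show ?case
  proof (intro bexI[of _ "g1 + g2"] allI)
    fix s t
    show "f1 (s, t) + f2 (s, t) = f1 (a, t) + f2 (a, t) + (s - a) * (g1 + g2) (s, t)"
      using g(3)[rule_format, of s t] g(4)[rule_format, of s t] by (simp add: distrib_left)
  qed (use g fspan_add in blast)
next
  case (scale c f1)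
  then obtain g where g: "g \<in> fspan {monomial m n |m n. m + n < d - 1}"
    "\<forall>s t. f1 (s, t) = f1 (a, t) + (s - a) * g (s, t)" by blast
  show ?case
  proof (intro bexI[of _ "\<lambda>z. c * g z"] allI)
    fix s t
    show "c * f1 (s, t) = c * f1 (a, t) + (s - a) * (c * g (s, t))"
      using g(2)[rule_format, of s t] by (simp add: distrib_left)
  qed (use g fspan_scale in blast)
next
  case (base f)
  then obtain m n where f: "f = monomial m n" "m + n < d" by blast
  define g where "g = (\<lambda>z. \<Sum>i<m. a ^ (m - Suc i) * monomial i n z)"
  have "g \<in> total_below (d - 1)"
    unfolding g_def total_below_def
    using f(2) by (intro fspan_lincomb fspan_base) force
  moreover have "f (s, t) = f (a, t) + (s - a) * g (s, t)" for s t
  proof -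
    have "(s - a) * g (s, t) = (s - a) * (\<Sum>i<m. a ^ (m - Suc i) * s ^ i) * t ^ n"
      by (simp add: g_def monomial_def sum_distrib_right mult.assoc)
    also have "\<dots> = (s ^ m - a ^ m) * t ^ n"
      by (simp add: power_diff_sumr2)
    finally show ?thesis
      by (simp add: f(1) monomial_def left_diff_distrib)
  qed
  ultimately show ?case
    unfolding total_below_def by blast
qed

lemma total_below_factor_x:
  assumes "f \<in> total_below d" "\<And>t. f (a, t) = 0"
  obtains g where "g \<in> total_below (d - 1)" "\<And>s t. f (s, t) = (s - a) * g (s, t)"
  using total_below_divide_x[OF assms(1), of a] assms(2) by auto

lemma total_below_factor_y:
  assumes "f \<in> total_below d" "\<And>s. f (s, b) = 0"
  obtains g where "g \<in> total_below (d - 1)" "\<And>s t. f (s, t) = (t - b) * g (s, t)"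
proof -
  have "f \<circ> prod.swap \<in> total_below d"
    using assms(1) by (rule total_below_swap)
  then obtain g where g: "g \<in> total_below (d - 1)"
    "\<And>s t. (f \<circ> prod.swap) (s, t) = (s - b) * g (s, t)"
    by (rule total_below_factor_x[where a = b]) (use assms(2) in auto)
  show ?thesis
  proof (rule that[of "g \<circ> prod.swap"])
    show "g \<circ> prod.swap \<in> total_below (d - 1)"
      using g(1) by (rule total_below_swap)
    show "f (s, t) = (t - b) * (g \<circ> prod.swap) (s, t)" for s t
      using g(2)[of t s] by simp
  qed
qed

lemma total_below_slice_y: "f \<in> total_below d \<Longrightarrow> (\<lambda>t. f (s, t)) \<in> poly_funs d"
  using total_below_subset poly_funs_slice_y by blast

lemma total_below_slice_x: "f \<in> total_below d \<Longrightarrow> (\<lambda>s. f (s, t)) \<in> poly_funs d"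
  using total_below_subset poly_funs_slice_x by blast

text \<open>Caratheodory's form of the derivative: once a linear factor is split off, the normal
  derivative on its line is the value of the cofactor.\<close>

lemma deriv_linear_factor:
  fixes F G :: "real \<Rightarrow> real"
  assumes "\<And>u. F u = (u - c) * G u" "isCont G c"
  shows "deriv F c = G c"
  using assms by (intro DERIV_imp_deriv) (auto simp: CARAT_DERIV intro!: exI[of _ G])

text \<open>The longest column of the triangle has as many nodes as the restriction of
  \<open>g\<close> to it has coefficients, so \<open>g\<close> vanishes on that line. Splitting off
  the line lowers the degree by one and leaves the next smaller triangle.\<close>

lemma total_below_zero_by_triangle:
  assumes "g \<in> total_below d" "inj_on \<xi> {1..d}" "inj_on \<eta> {1..d}"
    and "\<And>i j. 1 \<le> j \<Longrightarrow> j \<le> i \<Longrightarrow> i \<le> d \<Longrightarrow> g (\<xi> i, \<eta> j) = 0"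
  shows "g z = 0"
  using assms
proof (induction d arbitrary: g z)
  case 0
  then show ?case by (simp add: total_below_0)
next
  case (Suc d)
  have "g (\<xi> (Suc d), t) = 0" for t
  proof (rule poly_funs_zero_by_roots[where u = "\<lambda>t. g (\<xi> (Suc d), t)"])
    show "(\<lambda>t. g (\<xi> (Suc d), t)) \<in> poly_funs (Suc d)"
      by (rule total_below_slice_y[OF Suc.prems(1)])
    show "Suc d \<le> card (\<eta> ` {1..Suc d})"
      using card_image[OF Suc.prems(3)] by simp
  qed (use Suc.prems(4) in auto)
  then obtain g' where g': "g' \<in> total_below d" "\<And>s t. g (s, t) = (s - \<xi> (Suc d)) * g' (s, t)"
    using total_below_factor_x[OF Suc.prems(1), of "\<xi> (Suc d)"] by (metis diff_Suc_1)
  have "g' (\<xi> i, \<eta> j) = 0" if "1 \<le> j" "j \<le> i" "i \<le> d" for i j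
  proof -
    have "\<xi> i \<noteq> \<xi> (Suc d)"
      using Suc.prems(2) that by (auto dest: inj_onD)
    moreover have "g (\<xi> i, \<eta> j) = 0"
      using Suc.prems(4) that by simp
    ultimately show ?thesis using g'(2) by simp
  qed
  moreover have "inj_on \<xi> {1..d}" "inj_on \<eta> {1..d}"
    using Suc.prems(2,3) by (auto intro: inj_on_subset)
  ultimately have "g' z = 0"
    using Suc.IH[OF g'(1)] by blast
  then show ?case using g'(2) by (cases z) simp
qed

text \<open>Extended by zero to a rectangle, the combination is a polynomial in s with coefficients
  polynomial in t; the univariate identity theorem applies twice.\<close>

lemma monomials_independent:
  assumes fin: "finite M" and zero: "\<And>z. (\<Sum>(m, n)\<in>M. c m n * monomial m n z) = 0"
    and mn: "(m, n) \<in> M"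
  shows "c m n = 0"
proof -
  obtain N where N: "M \<subseteq> {..N} \<times> {..N}"
  proof
    show "M \<subseteq> {..Max (fst ` M \<union> snd ` M)} \<times> {..Max (fst ` M \<union> snd ` M)}"
      using fin by (force intro!: Max_ge)
  qed
  define c' where "c' m n = (if (m, n) \<in> M then c m n else 0)" for m n
  have "(\<Sum>m\<le>N. (\<Sum>n\<le>N. c' m n * t ^ n) * s ^ m) = 0" for s t
  proof -
    have "(\<Sum>m\<le>N. (\<Sum>n\<le>N. c' m n * t ^ n) * s ^ m) =
        (\<Sum>(m, n)\<in>{..N} \<times> {..N}. c' m n * monomial m n (s, t))"
      by (simp add: sum_distrib_right sum_distrib_left monomial_def mult_ac flip: sum.cartesian_product)
    also have "\<dots> = (\<Sum>(m, n)\<in>M. c m n * monomial m n (s, t))"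
      using N by (intro sum.mono_neutral_cong_right) (auto simp: c'_def)
    finally show ?thesis using zero by simp
  qed
  then have "\<forall>m\<le>N. (\<Sum>n\<le>N. c' m n * t ^ n) = 0" for t
    using polyfun_eq_0[of "\<lambda>m. \<Sum>n\<le>N. c' m n * t ^ n" N] by blast
  then have "\<forall>n\<le>N. c' m n = 0" if "m \<le> N" for m
    using polyfun_eq_0[of "c' m" N] that by blast
  with N mn show ?thesis by (force simp: c'_def)
qed

subsection \<open>Polynomials on the square\<close>

locale bfs_square =
  fixes k :: nat and a b h :: real and x :: "nat \<Rightarrow> real \<times> real"
  assumes k_ge_6: "k \<ge> 6" and h_pos: "h > 0"
    and vertices: "x 1 = (a, b)" "x 2 = (a + h, b)" "x 3 = (a + h, b + h)" "x 4 = (a, b + h)"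
begin

text \<open>The coordinate decreases from c + h at \<open>j = 0\<close> to c at
  \<open>j = k - 2\<close>, since \<open>j\<close> weights the lower end point of an edge. All four
  edges and, in both coordinates, the nodes of Row 6 share this formula.\<close>

definition node :: "real \<Rightarrow> nat \<Rightarrow> real" where
  "node c j = c + h * (real k - 2 - real j) / (real k - 2)"

lemma k_minus_2_pos: "real k - 2 > 0"
  using k_ge_6 by simp

lemma node_eq_iff [simp]: "node c i = node c j \<longleftrightarrow> i = j"
  using h_pos k_minus_2_pos by (auto simp: node_def divide_simps)

lemma node_inj: "inj_on (node c) J"
  by (rule inj_onI) simp

lemma node_bounds:
  assumes "1 \<le> j" "j \<le> k - 3"
  shows "c < node c j" "node c j < c + h"
proof -
  have "real j \<le> real k - 3" using assms k_ge_6 by linarith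
  then show "c < node c j"
    using h_pos k_minus_2_pos by (simp add: node_def)
  have "h * (real k - 2 - real j) < h * (real k - 2)"
    using assms(1) h_pos by (intro mult_strict_left_mono) auto
  then show "node c j < c + h"
    using k_minus_2_pos by (simp add: node_def pos_divide_less_eq)
qed

text \<open>Common form of the one-variable problems on an edge: the k - 2 - j0 nodes with index at
  least \<open>j0\<close>, end points \<open>E\<close> with the value only, end points
  \<open>B\<close> with value and derivative.\<close>

lemma edge_zero:
  assumes "u \<in> poly_funs d" "1 \<le> j0" "\<And>j. j0 \<le> j \<Longrightarrow> j \<le> k - 3 \<Longrightarrow> u (node c j) = 0"
    and "E \<subseteq> {c, c + h}" "B \<subseteq> {c, c + h}" "E \<inter> B = {}"
    and "\<And>r. r \<in> E \<Longrightarrow> u r = 0" "\<And>r. r \<in> B \<Longrightarrow> u r = 0" "\<And>r. r \<in> B \<Longrightarrow> deriv u r = 0"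
    and "d \<le> (k - 2 - j0) + card E + 2 * card B"
  shows "u t = 0"
proof (rule poly_funs_Hermite_zero[OF assms(1), of "node c ` {j0..k - 3} \<union> E" B])
  have fin: "finite E" "finite B"
    using assms(4,5) by (auto intro: finite_subset)
  then show "finite (node c ` {j0..k - 3} \<union> E)" "finite B" by auto
  have disj: "node c ` {j0..k - 3} \<inter> {c, c + h} = {}"
  proof -
    have "node c j \<notin> {c, c + h}" if "j \<in> {j0..k - 3}" for j
      using node_bounds[of j c] assms(2) that by auto
    then show ?thesis by blast
  qed
  with assms(5,6) show "(node c ` {j0..k - 3} \<union> E) \<inter> B = {}" by blast
  have "card (node c ` {j0..k - 3} \<union> E) = card (node c ` {j0..k - 3}) + card E"
  proof (rule card_Un_disjoint)
    show "node c ` {j0..k - 3} \<inter> E = {}" using disj assms(4) by blast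
  qed (use fin in auto)
  also have "card (node c ` {j0..k - 3}) = Suc (k - 3) - j0"
    by (simp add: card_image[OF node_inj])
  finally show "d \<le> card (node c ` {j0..k - 3} \<union> E) + 2 * card B"
    using assms(10) k_ge_6 by linarith
qed (use assms(3,7,8,9) in auto)

lemmas edge_zero_Hermite = edge_zero[where E = "{}", simplified]
  and edge_zero_nodes = edge_zero[where E = "{}" and B = "{}", simplified]

text \<open>A tensor product argument: k - 3 nodes and two double end points match the k + 1
  coefficients in one variable. Applied to vertical lines, this kills \<open>f\<close> on all node
  lines and both vertical edges and \<open>dx f\<close> on those edges; every horizontal line then
  carries the same set of conditions.\<close>

lemma Q_zero:
  assumes f: "f \<in> partial_below (Suc k) (Suc k)"
    and vertex: "\<And>c1 c2. c1 \<in> {a, a + h} \<Longrightarrow> c2 \<in> {b, b + h} \<Longrightarrow>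
      f (c1, c2) = 0 \<and> dx f (c1, c2) = 0 \<and> dy f (c1, c2) = 0 \<and> dxy f (c1, c2) = 0"
    and horizontal: "\<And>c2 j. c2 \<in> {b, b + h} \<Longrightarrow> 1 \<le> j \<Longrightarrow> j \<le> k - 3 \<Longrightarrow>
      f (node a j, c2) = 0 \<and> dy f (node a j, c2) = 0"
    and vertical: "\<And>c1 j. c1 \<in> {a, a + h} \<Longrightarrow> 1 \<le> j \<Longrightarrow> j \<le> k - 3 \<Longrightarrow>
      f (c1, node b j) = 0 \<and> dx f (c1, node b j) = 0"
    and inner: "\<And>i j. 1 \<le> i \<Longrightarrow> i \<le> k - 3 \<Longrightarrow> 1 \<le> j \<Longrightarrow> j \<le> k - 3 \<Longrightarrow> f (node a i, node b j) = 0"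
  shows "f z = 0"
proof -
  have card2: "card {c, c + h} = 2" for c :: real
    using h_pos by simp
  have trace: "f (c1, t) = 0" if "c1 \<in> {a, a + h}" for c1 t
    by (rule edge_zero_Hermite[where u = "\<lambda>t. f (c1, t)" and B = "{b, b + h}" and c = b,
          OF poly_funs_slice_y[OF f], of 1])
      (use that vertical vertex card2 k_ge_6 in \<open>auto simp: dy_eq_deriv_slice\<close>)
  have normal: "dx f (c1, t) = 0" if "c1 \<in> {a, a + h}" for c1 t
    by (rule edge_zero_Hermite[where u = "\<lambda>t. dx f (c1, t)" and B = "{b, b + h}" and c = b,
          OF poly_funs_slice_y[OF dx_in_partial_below[OF f]], of 1])
      (use that vertical vertex card2 k_ge_6 in \<open>auto simp: dxy_eq_deriv_slice\<close>)
  have line: "f (node a i, t) = 0" if "1 \<le> i" "i \<le> k - 3" for i t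
    by (rule edge_zero_Hermite[where u = "\<lambda>t. f (node a i, t)" and B = "{b, b + h}" and c = b,
          OF poly_funs_slice_y[OF f], of 1])
      (use that horizontal inner card2 k_ge_6 in \<open>auto simp: dy_eq_deriv_slice\<close>)
  have "f (s, t) = 0" for s t
    by (rule edge_zero_Hermite[where u = "\<lambda>s. f (s, t)" and B = "{a, a + h}" and c = a,
          OF poly_funs_slice_x[OF f], of 1])
      (use trace normal line card2 k_ge_6 in \<open>auto simp: dx_eq_deriv_slice\<close>)
  then show ?thesis by (cases z) simp
qed

definition bubble :: "real \<Rightarrow> real \<Rightarrow> real" where
  "bubble s t = (s - a)\<^sup>2 * (s - (a + h))\<^sup>2 * (t - b)\<^sup>2 * (t - (b + h))\<^sup>2"

text \<open>Each linear factor that is split off lowers the degree by one and so saves one condition on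
  every edge still to be treated; hence the growing lower bounds on the node indices.\<close>

lemma P_bubble_factor:
  assumes f: "f \<in> total_below (Suc k)"
    and x1: "f (a, b) = 0" "dx f (a, b) = 0" "dy f (a, b) = 0" "dxy f (a, b) = 0"
    and x3: "f (a + h, b + h) = 0" "dx f (a + h, b + h) = 0" "dy f (a + h, b + h) = 0"
    and x4: "f (a, b + h) = 0" "dy f (a, b + h) = 0" "dxy f (a, b + h) = 0"
    and bottom: "\<And>j. 3 \<le> j \<Longrightarrow> j \<le> k - 3 \<Longrightarrow> f (node a j, b) = 0"
      "\<And>j. 4 \<le> j \<Longrightarrow> j \<le> k - 3 \<Longrightarrow> dy f (node a j, b) = 0"
    and right: "\<And>j. 1 \<le> j \<Longrightarrow> j \<le> k - 3 \<Longrightarrow> f (a + h, node b j) = 0"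
      "\<And>j. 2 \<le> j \<Longrightarrow> j \<le> k - 3 \<Longrightarrow> dx f (a + h, node b j) = 0"
    and top: "\<And>j. 1 \<le> j \<Longrightarrow> j \<le> k - 3 \<Longrightarrow> f (node a j, b + h) = 0"
      "\<And>j. 1 \<le> j \<Longrightarrow> j \<le> k - 3 \<Longrightarrow> dy f (node a j, b + h) = 0"
    and left: "\<And>j. 1 \<le> j \<Longrightarrow> j \<le> k - 3 \<Longrightarrow> f (a, node b j) = 0"
      "\<And>j. 1 \<le> j \<Longrightarrow> j \<le> k - 3 \<Longrightarrow> dx f (a, node b j) = 0"
  obtains g where "g \<in> total_below (k - 7)" "\<And>s t. f (s, t) = bubble s t * g (s, t)"
proof -
  have node_ne: "node c j \<noteq> c" "node c j \<noteq> c + h" if "1 \<le> j" "j \<le> k - 3" for c j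
    using node_bounds[OF that, of c] by auto
  have "card {b, b + h} = 2"
    using h_pos by simp
  then have bound: "Suc k \<le> k - 2 - 1 + 2 * card {b, b + h}"
    using k_ge_6 by simp

  \<comment> \<open>Left trace: k + 1 coefficients against k - 3 nodes and two double end
    points.\<close>
  have "f (a, t) = 0" for t
    by (rule edge_zero_Hermite[where u = "\<lambda>t. f (a, t)" and B = "{b, b + h}" and c = b,
          OF total_below_slice_y[OF f], of 1])
      (use x1 x4 left bound in \<open>auto simp: dy_eq_deriv_slice\<close>)
  then obtain f1 where f1: "f1 \<in> total_below k" "\<And>s t. f (s, t) = (s - a) * f1 (s, t)"
    by (rule total_below_factor_x[OF f]) simp
  have dx_left: "dx f (a, t) = f1 (a, t)" for t
    unfolding dx_eq_deriv_slice
    by (rule deriv_linear_factor[of _ a "\<lambda>s. f1 (s, t)"])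
      (rule f1(2), rule poly_funs_isCont[OF total_below_slice_x[OF f1(1)]])

  \<comment> \<open>Left normal derivative: with \<open>dx f\<close> free at the upper corner, only
    the tangential derivative of \<open>f1\<close> is known there, which calls for Birkhoff
    interpolation.\<close>
  have "f1 (a, t) = 0" for t
  proof (rule poly_funs_Birkhoff_zero[where u = "\<lambda>t. f1 (a, t)" and A = "node b ` {1..k - 3}"
        and b = b and T = "b + h", OF total_below_slice_y[OF f1(1)]])
    show "f1 (a, b) = 0" using x1(2) dx_left by simp
    show "b \<notin> node b ` {1..k - 3}" using node_ne(1)[of _ b] by force
    show "deriv (\<lambda>t. f1 (a, t)) b = 0" "deriv (\<lambda>t. f1 (a, t)) (b + h) = 0"
      using x1(4) x4(3) by (simp_all add: dxy_eq_deriv_slice dx_left)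
    show "k \<le> card (node b ` {1..k - 3}) + 3"
      using k_ge_6 by (simp add: card_image[OF node_inj])
  qed (use h_pos node_ne node_bounds left(2) dx_left in \<open>auto simp: image_iff\<close>)
  then obtain f2 where f2: "f2 \<in> total_below (k - 1)" "\<And>s t. f1 (s, t) = (s - a) * f2 (s, t)"
    by (rule total_below_factor_x[OF f1(1)]) simp
  have f_f2: "f (s, t) = (s - a)\<^sup>2 * f2 (s, t)" for s t
    by (simp add: f1 f2 power2_eq_square)

  \<comment> \<open>Top trace: the double factor at s = a has already absorbed the left end, so k -
    3 nodes and a double right end match k - 1 coefficients.\<close>
  have "f2 (s, b + h) = 0" for s
  proof (rule edge_zero_Hermite[where u = "\<lambda>s. f2 (s, b + h)" and B = "{a + h}" and c = a,
        OF total_below_slice_x[OF f2(1)], of 1])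
    show zero: "f2 (r, b + h) = 0" if "r \<in> {a + h}" for r
      using that x3(1) h_pos by (simp add: f_f2)
    show "deriv (\<lambda>s. f2 (s, b + h)) r = 0" if "r \<in> {a + h}" for r
    proof -
      let ?D = "deriv (\<lambda>s. f2 (s, b + h)) (a + h)"
      have "((\<lambda>s. f2 (s, b + h)) has_real_derivative ?D) (at (a + h))"
        by (rule poly_funs_DERIV[OF total_below_slice_x[OF f2(1)]])
      \<comment> \<open>Since \<open>f2\<close> vanishes at the corner, the product rule for (s -
        a)^2 \<open>f2\<close> leaves only the term with the derivative of
        \<open>f2\<close>.\<close>
      then have "((\<lambda>s. f (s, b + h)) has_real_derivative h\<^sup>2 * ?D) (at (a + h))"
        unfolding f_f2 using zero by (auto intro!: derivative_eq_intros)
      then have "h\<^sup>2 * ?D = 0"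
        using x3(2) by (simp add: dx_eq_deriv_slice DERIV_imp_deriv)
      then show ?thesis using h_pos that by simp
    qed
    show "f2 (node a j, b + h) = 0" if "1 \<le> j" "j \<le> k - 3" for j
      using top(1)[OF that] node_ne[OF that] by (simp add: f_f2)
  qed (use k_ge_6 in auto)
  then obtain f3 where f3: "f3 \<in> total_below (k - 2)"
    "\<And>s t. f2 (s, t) = (t - (b + h)) * f3 (s, t)"
    by (rule total_below_factor_y[OF f2(1)]) (simp add: numeral_2_eq_2)
  have dy_top: "dy f (s, b + h) = (s - a)\<^sup>2 * f3 (s, b + h)" for s
    unfolding dy_eq_deriv_slice
    by (rule deriv_linear_factor[of _ "b + h" "\<lambda>t. (s - a)\<^sup>2 * f3 (s, t)"])
      (auto simp: f_f2 f3 intro!: continuous_intros poly_funs_isCont[OF total_below_slice_y[OF f3(1)]])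

  \<comment> \<open>Top normal derivative: k - 3 nodes and the value at the right end match k - 2
    coefficients, which leaves \<open>dxy\<close> at that corner free.\<close>
  have "f3 (s, b + h) = 0" for s
    by (rule edge_zero[where u = "\<lambda>s. f3 (s, b + h)" and E = "{a + h}" and B = "{}" and c = a,
          OF total_below_slice_x[OF f3(1)], of 1])
      (use x3(3) top(2) node_ne h_pos k_ge_6 in \<open>auto simp: dy_top\<close>)
  then obtain f4 where f4: "f4 \<in> total_below (k - 3)"
    "\<And>s t. f3 (s, t) = (t - (b + h)) * f4 (s, t)"
    by (rule total_below_factor_y[OF f3(1)]) (simp add: numeral_eq_Suc)
  have f_f4: "f (s, t) = (s - a)\<^sup>2 * (t - (b + h))\<^sup>2 * f4 (s, t)" for s t
    by (simp add: f_f2 f3 f4 power2_eq_square)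

  \<comment> \<open>Right trace: the k - 3 nodes suffice, so nothing is asked at the lower right
    corner.\<close>
  have "f4 (a + h, t) = 0" for t
    by (rule edge_zero_nodes[where u = "\<lambda>t. f4 (a + h, t)" and c = b,
          OF total_below_slice_y[OF f4(1)], of 1])
      (use right(1) node_ne h_pos in \<open>auto simp: f_f4\<close>)
  then obtain f5 where f5: "f5 \<in> total_below (k - 4)"
    "\<And>s t. f4 (s, t) = (s - (a + h)) * f5 (s, t)"
    by (rule total_below_factor_x[OF f4(1)]) (simp add: numeral_eq_Suc)
  have dx_right: "dx f (a + h, t) = h\<^sup>2 * (t - (b + h))\<^sup>2 * f5 (a + h, t)" for t
    unfolding dx_eq_deriv_slice
    by (rule deriv_linear_factor[of _ "a + h" "\<lambda>s. (s - a)\<^sup>2 * (t - (b + h))\<^sup>2 * f5 (s, t)",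
          simplified])
      (auto simp: f_f4 f5 intro!: continuous_intros poly_funs_isCont[OF total_below_slice_x[OF f5(1)]])

  \<comment> \<open>Right normal derivative: k - 4 coefficients, so the node \<open>j = 1\<close> is
    spared.\<close>
  have "f5 (a + h, t) = 0" for t
    by (rule edge_zero_nodes[where u = "\<lambda>t. f5 (a + h, t)" and c = b,
          OF total_below_slice_y[OF f5(1)], of 2])
      (use right(2) node_ne h_pos in \<open>auto simp: dx_right\<close>)
  then obtain f6 where f6: "f6 \<in> total_below (k - 5)"
    "\<And>s t. f5 (s, t) = (s - (a + h)) * f6 (s, t)"
    by (rule total_below_factor_x[OF f5(1)]) (simp add: numeral_eq_Suc)
  have f_f6: "f (s, t) = (s - a)\<^sup>2 * (s - (a + h))\<^sup>2 * (t - (b + h))\<^sup>2 * f6 (s, t)" for s t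
    by (simp add: f_f4 f5 f6 power2_eq_square)

  \<comment> \<open>Bottom trace: k - 5 coefficients, so the nodes \<open>j = 1, 2\<close> are
    spared.\<close>
  have "f6 (s, b) = 0" for s
    by (rule edge_zero_nodes[where u = "\<lambda>s. f6 (s, b)" and c = a,
          OF total_below_slice_x[OF f6(1)], of 3])
      (use bottom(1) node_ne h_pos in \<open>auto simp: f_f6\<close>)
  then obtain f7 where f7: "f7 \<in> total_below (k - 6)" "\<And>s t. f6 (s, t) = (t - b) * f7 (s, t)"
    by (rule total_below_factor_y[OF f6(1)]) (simp add: numeral_eq_Suc)
  have dy_bottom: "dy f (s, b) = (s - a)\<^sup>2 * (s - (a + h))\<^sup>2 * h\<^sup>2 * f7 (s, b)" for s
    unfolding dy_eq_deriv_slice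
    by (rule deriv_linear_factor[of _ b
          "\<lambda>t. (s - a)\<^sup>2 * (s - (a + h))\<^sup>2 * (t - (b + h))\<^sup>2 * f7 (s, t)", simplified])
      (auto simp: f_f6 f7 intro!: continuous_intros poly_funs_isCont[OF total_below_slice_y[OF f7(1)]])

  \<comment> \<open>Bottom normal derivative: k - 6 coefficients, so the nodes
    \<open>j = 1, 2, 3\<close> are spared; for k = 6 none remain and \<open>f7\<close> is already
    zero.\<close>
  have "f7 (s, b) = 0" for s
    by (rule edge_zero_nodes[where u = "\<lambda>s. f7 (s, b)" and c = a,
          OF total_below_slice_x[OF f7(1)], of 4])
      (use bottom(2) node_ne h_pos in \<open>auto simp: dy_bottom\<close>)
  then obtain f8 where f8: "f8 \<in> total_below (k - 7)" "\<And>s t. f7 (s, t) = (t - b) * f8 (s, t)"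
    by (rule total_below_factor_y[OF f7(1)]) (simp add: numeral_eq_Suc)
  show ?thesis
    by (rule that[OF f8(1)]) (simp add: bubble_def f_f6 f7 f8 power2_eq_square)
qed

text \<open>A double zero on an edge leaves one linear factor in the normal derivative. The mixed
  derivative is the tangential derivative of \<open>dx f\<close> along a vertical edge, where
  \<open>dx f\<close> is identically zero; these edges contain all vertices.\<close>

lemma bubble_multiple_boundary:
  assumes g: "g \<in> total_below d" and f: "\<And>s t. f (s, t) = bubble s t * g (s, t)"
  shows "s \<in> {a, a + h} \<Longrightarrow> f (s, t) = 0" "t \<in> {b, b + h} \<Longrightarrow> f (s, t) = 0"
    and "s \<in> {a, a + h} \<Longrightarrow> dx f (s, t) = 0" "t \<in> {b, b + h} \<Longrightarrow> dy f (s, t) = 0"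
    and "s \<in> {a, a + h} \<Longrightarrow> dxy f (s, t) = 0"
proof -
  show "s \<in> {a, a + h} \<Longrightarrow> f (s, t) = 0" "t \<in> {b, b + h} \<Longrightarrow> f (s, t) = 0"
    by (auto simp: f bubble_def)
  have cont: "isCont (\<lambda>s. g (s, t)) c" "isCont (\<lambda>t. g (s, t)) c" for s t c
    by (rule poly_funs_isCont[OF total_below_slice_x[OF g]],
        rule poly_funs_isCont[OF total_below_slice_y[OF g]])
  have "dx f (a, t) = 0" for t
    unfolding dx_eq_deriv_slice
    by (subst deriv_linear_factor[of _ a
          "\<lambda>s. (s - a) * ((s - (a + h))\<^sup>2 * (t - b)\<^sup>2 * (t - (b + h))\<^sup>2 * g (s, t))"])
      (auto simp: f bubble_def power2_eq_square intro!: continuous_intros cont)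
  moreover have "dx f (a + h, t) = 0" for t
    unfolding dx_eq_deriv_slice
    by (subst deriv_linear_factor[of _ "a + h"
          "\<lambda>s. (s - (a + h)) * ((s - a)\<^sup>2 * (t - b)\<^sup>2 * (t - (b + h))\<^sup>2 * g (s, t))"])
      (auto simp: f bubble_def power2_eq_square intro!: continuous_intros cont)
  ultimately have dx: "dx f (s, t) = 0" if "s \<in> {a, a + h}" for s t
    using that by auto
  then show "s \<in> {a, a + h} \<Longrightarrow> dx f (s, t) = 0" .
  have "dy f (s, b) = 0" for s
    unfolding dy_eq_deriv_slice
    by (subst deriv_linear_factor[of _ b
          "\<lambda>t. (t - b) * ((s - a)\<^sup>2 * (s - (a + h))\<^sup>2 * (t - (b + h))\<^sup>2 * g (s, t))"])
      (auto simp: f bubble_def power2_eq_square intro!: continuous_intros cont)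
  moreover have "dy f (s, b + h) = 0" for s
    unfolding dy_eq_deriv_slice
    by (subst deriv_linear_factor[of _ "b + h"
          "\<lambda>t. (t - (b + h)) * ((s - a)\<^sup>2 * (s - (a + h))\<^sup>2 * (t - b)\<^sup>2 * g (s, t))"])
      (auto simp: f bubble_def power2_eq_square intro!: continuous_intros cont)
  ultimately show "t \<in> {b, b + h} \<Longrightarrow> dy f (s, t) = 0"
    by auto
  show "s \<in> {a, a + h} \<Longrightarrow> dxy f (s, t) = 0"
    by (simp add: dxy_eq_deriv_slice dx)
qed

end

subsection \<open>The degrees of freedom\<close>

lemma concat_pairs_nth:
  assumes "i < length xs"
  shows "concat (map (\<lambda>j. [A j, B j]) xs) ! (2 * i) = A (xs ! i)"
    and "concat (map (\<lambda>j. [A j, B j]) xs) ! Suc (2 * i) = B (xs ! i)"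
  using assms by (induction xs arbitrary: i) (auto simp: less_Suc_eq_0_disj)

lemma length_concat_pairs: "length (concat (map (\<lambda>j. [A j, B j]) xs)) = 2 * length xs"
  by (induction xs) auto

lemma length_edge_dofs [simp]: "length (edge_dofs k D u v) = 2 * (k - 3)"
  by (simp add: edge_dofs_def length_concat_pairs)

text \<open>Counted from one, node \<open>j\<close> owns the odd position 2 j - 1 for its value and
  the even position 2 j for its normal derivative; list indices are one less.\<close>

lemma edge_dofs_nth:
  assumes "1 \<le> j" "j \<le> k - 3"
  shows "edge_dofs k D u v ! (2 * j - 2) = (\<lambda>p. p (edge_node k u v j))"
    and "edge_dofs k D u v ! (2 * j - 1) = (\<lambda>p. D p (edge_node k u v j))"
proof -
  obtain i where i: "j = Suc i" using assms(1) by (cases j) auto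
  then have "i < length [1..<k - 2]" "[1..<k - 2] ! i = j"
    using assms by auto
  then show "edge_dofs k D u v ! (2 * j - 2) = (\<lambda>p. p (edge_node k u v j))"
    "edge_dofs k D u v ! (2 * j - 1) = (\<lambda>p. D p (edge_node k u v j))"
    using concat_pairs_nth[of i "[1..<k - 2]" "\<lambda>j p. p (edge_node k u v j)"
        "\<lambda>j p. D p (edge_node k u v j)"]
    by (simp_all add: edge_dofs_def i)
qed

lemma set_edge_dofs:
  "set (edge_dofs k D u v) =
     (\<Union>j\<in>{1..k - 3}. {\<lambda>p. p (edge_node k u v j), \<lambda>p. D p (edge_node k u v j)})"
proof -
  have "set [1..<k - 2] = {1..k - 3}" by auto
  then show ?thesis by (simp add: edge_dofs_def)
qed

lemma length_inner_dofs [simp]: "length (inner_dofs k x) = (k - 3) * (k - 3)"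
  by (simp add: inner_dofs_def length_concat o_def sum_list_triv)

lemma set_inner_dofs:
  "set (inner_dofs k x) = (\<Union>j\<in>{1..k - 3}. \<Union>l\<in>{1..k - 3}. {\<lambda>p. p (inner_node k x j l)})"
proof -
  have "set [1..<k - 2] = {1..k - 3}" by auto
  then show ?thesis by (auto simp: inner_dofs_def)
qed

lemma vertex_dofs_eq:
  "vertex_dofs x =
     [\<lambda>p. p (x 1), \<lambda>p. dx p (x 1), \<lambda>p. dy p (x 1), \<lambda>p. dxy p (x 1),
      \<lambda>p. p (x 2), \<lambda>p. dx p (x 2), \<lambda>p. dy p (x 2), \<lambda>p. dxy p (x 2),
      \<lambda>p. p (x 3), \<lambda>p. dx p (x 3), \<lambda>p. dy p (x 3), \<lambda>p. dxy p (x 3),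
      \<lambda>p. p (x 4), \<lambda>p. dx p (x 4), \<lambda>p. dy p (x 4), \<lambda>p. dxy p (x 4)]"
proof -
  have "[1..<5] = [1, 2, 3, 4 :: nat]" by (simp add: upt_rec)
  then show ?thesis by (simp add: vertex_dofs_def)
qed

lemma set_vertex_dofs:
  "set (vertex_dofs x) =
     (\<Union>i\<in>{1, 2, 3, 4}. {\<lambda>p. p (x i), \<lambda>p. dx p (x i), \<lambda>p. dy p (x i), \<lambda>p. dxy p (x i)})"
  unfolding vertex_dofs_eq by auto

text \<open>A triangular number, doubled to avoid division. Truncated subtraction makes both sides
  zero for k at most 7.\<close>

lemma length_serendipity_inner_dofs:
  "2 * length (serendipity_inner_dofs k x) = (k - 7) * (k - 6)"
proof -
  have "length (serendipity_inner_dofs k x) = (\<Sum>i\<in>{1..<k - 6}. i)"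
    by (auto simp: serendipity_inner_dofs_def length_concat o_def interv_sum_list_conv_sum_set_nat)
  also have "2 * (\<Sum>i\<in>{1..<k - 6}. i) = (k - 7) * (k - 6)"
  proof (cases "k \<ge> 7")
    case True
    then obtain n where k: "k = n + 7" by (metis add.commute le_Suc_ex)
    have "2 * (\<Sum>i\<in>{1..<Suc n}. i) = n * Suc n"
      by (induction n) auto
    then show ?thesis by (simp add: k)
  qed auto
  finally show ?thesis .
qed

lemma bfs_row_linear:
  assumes "\<phi> \<in> set (bfs_row k x s)"
  shows "linear_dof_on (Q_space k) \<phi>"
proof -
  have "\<phi> \<in> range (\<lambda>z p. p z) \<union> range (\<lambda>z p. dx p z) \<union> range (\<lambda>z p. dy p z) \<union> range (\<lambda>z p. dxy p z)"
    using assms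
    by (auto simp: bfs_row_def set_vertex_dofs set_edge_dofs set_inner_dofs split: if_splits)
  then show ?thesis
    unfolding Q_space_eq
    by (auto intro: linear_dof_value linear_dof_dx linear_dof_dy linear_dof_dxy)
qed

lemma set_V_dofs:
  "set (V_dofs k x) = (\<Union>s\<in>{1..5}. set (bfs_row k x s)) \<union> set (serendipity_inner_dofs k x)"
proof -
  have "{1..5} = {1, 2, 3, 4, 5 :: nat}" by auto
  then show ?thesis by (auto simp: V_dofs_def bfs_row_def)
qed

lemma V_dofs_linear:
  assumes "\<phi> \<in> set (V_dofs k x)"
  shows "linear_dof_on (Q_space k) \<phi>"
  using assms bfs_row_linear
  by (auto simp: set_V_dofs serendipity_inner_dofs_def intro: linear_dof_value split: if_splits)

context bfs_square
begin

section \<open>The nodes in coordinates\<close>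

lemma edge_node_eq:
  "edge_node k (x 1) (x 2) j = (node a j, b)" "edge_node k (x 2) (x 3) j = (a + h, node b j)"
  "edge_node k (x 4) (x 3) j = (node a j, b + h)" "edge_node k (x 1) (x 4) j = (a, node b j)"
proof -
  define K where "K = real k - 2"
  have "K \<noteq> 0" using k_minus_2_pos by (simp add: K_def)
  then show "edge_node k (x 1) (x 2) j = (node a j, b)"
    "edge_node k (x 2) (x 3) j = (a + h, node b j)"
    "edge_node k (x 4) (x 3) j = (node a j, b + h)"
    "edge_node k (x 1) (x 4) j = (a, node b j)"
    unfolding edge_node_def node_def vertices K_def[symmetric] by (simp_all add: field_simps)
qed

text \<open>The indices change places: \<open>l\<close> weights the left edge against the right one
  and so fixes the first coordinate.\<close>

lemma inner_node_eq: "inner_node k x j l = (node a l, node b j)"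
proof -
  define K where "K = real k - 2"
  have "K \<noteq> 0" using k_minus_2_pos by (simp add: K_def)
  then show ?thesis
    unfolding inner_node_def node_def Let_def vertices K_def[symmetric] by (simp add: field_simps power2_eq_square)
qed

lemma serendipity_node_eq:
  "serendipity_node k x i j = (a + h * real i / (real k - 2), b + h * real j / (real k - 2))"
proof -
  define K where "K = real k - 2"
  have "K \<noteq> 0" using k_minus_2_pos by (simp add: K_def)
  then show ?thesis
    unfolding serendipity_node_def vertices K_def[symmetric] by (simp add: field_simps)
qed

lemma edge_dofs_in_rows:
  assumes "1 \<le> j" "j \<le> k - 3"
  shows "(\<lambda>p. p (node a j, b)) \<in> set (bfs_row k x 2)" "(\<lambda>p. dy p (node a j, b)) \<in> set (bfs_row k x 2)"
    and "(\<lambda>p. p (a + h, node b j)) \<in> set (bfs_row k x 3)"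
      "(\<lambda>p. dx p (a + h, node b j)) \<in> set (bfs_row k x 3)"
    and "(\<lambda>p. p (node a j, b + h)) \<in> set (bfs_row k x 4)"
      "(\<lambda>p. dy p (node a j, b + h)) \<in> set (bfs_row k x 4)"
    and "(\<lambda>p. p (a, node b j)) \<in> set (bfs_row k x 5)" "(\<lambda>p. dx p (a, node b j)) \<in> set (bfs_row k x 5)"
  using assms unfolding edge_node_eq[symmetric] by (auto simp: bfs_row_def set_edge_dofs)

section \<open>Unisolvence of the Bogner-Fox-Schmit element\<close>

lemma Q_dofs_zero:
  assumes f: "f \<in> Q_space k" and zero: "\<And>s \<phi>. s \<in> {1..6} \<Longrightarrow> \<phi> \<in> set (bfs_row k x s) \<Longrightarrow> \<phi> f = 0"
  shows "f z = 0"
proof (rule Q_zero)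
  have vertex: "f (x i) = 0 \<and> dx f (x i) = 0 \<and> dy f (x i) = 0 \<and> dxy f (x i) = 0" if "i \<in> {1, 2, 3, 4}" for i
    using that zero[of 1] by (auto simp: bfs_row_def set_vertex_dofs)
  show "f (c1, c2) = 0 \<and> dx f (c1, c2) = 0 \<and> dy f (c1, c2) = 0 \<and> dxy f (c1, c2) = 0"
    if "c1 \<in> {a, a + h}" "c2 \<in> {b, b + h}" for c1 c2
    using that vertex[of 1, unfolded vertices] vertex[of 2, unfolded vertices]
      vertex[of 3, unfolded vertices] vertex[of 4, unfolded vertices] by auto
  show "f (node a j, c2) = 0 \<and> dy f (node a j, c2) = 0"
    if "c2 \<in> {b, b + h}" "1 \<le> j" "j \<le> k - 3" for c2 j
    using that zero[OF _ edge_dofs_in_rows(1)] zero[OF _ edge_dofs_in_rows(2)]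
      zero[OF _ edge_dofs_in_rows(5)] zero[OF _ edge_dofs_in_rows(6)] by auto
  show "f (c1, node b j) = 0 \<and> dx f (c1, node b j) = 0"
    if "c1 \<in> {a, a + h}" "1 \<le> j" "j \<le> k - 3" for c1 j
    using that zero[OF _ edge_dofs_in_rows(3)] zero[OF _ edge_dofs_in_rows(4)]
      zero[OF _ edge_dofs_in_rows(7)] zero[OF _ edge_dofs_in_rows(8)] by auto
  show "f (node a i, node b j) = 0" if "1 \<le> i" "i \<le> k - 3" "1 \<le> j" "j \<le> k - 3" for i j
  proof -
    have "(\<lambda>p. p (node a i, node b j)) \<in> set (bfs_row k x 6)"
      using that by (simp add: bfs_row_def set_inner_dofs inner_node_eq)
        (intro bexI[of _ j] bexI[of _ i]; simp)
    then show ?thesis using zero[of 6] by auto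
  qed
qed (use f Q_space_eq in auto)

text \<open>With a unit vector for \<open>d\<close> this is the existence and uniqueness behind the
  definite description in \<open>bfs_basis\<close>.\<close>

lemma Q_unisolvent:
  "\<exists>!p. p \<in> Q_space k \<and>
     (\<forall>s\<in>{1..6}. \<forall>m\<in>{1..length (bfs_row k x s)}. (bfs_row k x s ! (m - 1)) p = d s m)"
proof -
  define I where "I = Sigma {1..6} (\<lambda>s. {1..length (bfs_row k x s)})"
  define J where "J = {..k} \<times> {..k}"
  define g where "g = (\<lambda>(m, n). monomial m n)"
  define \<phi> where "\<phi> = (\<lambda>(s, m). bfs_row k x s ! (m - 1))"
  have Q: "Q_space k = fspan (g ` J)"
    unfolding Q_space_def by (rule arg_cong[of _ _ fspan]) (auto simp: g_def J_def)
  have \<phi>: "\<phi> (s, m) \<in> set (bfs_row k x s)" if "(s, m) \<in> I" for s m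
    using that by (auto simp: I_def \<phi>_def)
  have "\<exists>!p. p \<in> fspan (g ` J) \<and> (\<forall>i\<in>I. \<phi> i p = case_prod d i)"
  proof (rule unisolvent_fspan)
    show "finite I" "finite J" by (auto simp: I_def J_def)
    have "{1..6} = {1, 2, 3, 4, 5, 6 :: nat}" by auto
    \<comment> \<open>The count is the square of (k - 3) + 4 = k + 1.\<close>
    then have "card I = 16 + 8 * (k - 3) + (k - 3) * (k - 3)"
      by (simp add: I_def bfs_row_def vertex_dofs_eq)
    also obtain n where n: "k = n + 6" using k_ge_6 by (metis add.commute le_Suc_ex)
    have "16 + 8 * (k - 3) + (k - 3) * (k - 3) = card J"
      by (simp add: J_def n card_cartesian_product algebra_simps)
    finally show "card I = card J" .
    show "g j \<in> fspan (g ` J)" if "j \<in> J" for j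
      using that by (intro fspan_base) auto
    show "linear_dof_on (fspan (g ` J)) (\<phi> i)" if "i \<in> I" for i
      using that bfs_row_linear[OF \<phi>] unfolding Q[symmetric] by (cases i) blast
  next
    fix c assume zero: "\<And>i. i \<in> I \<Longrightarrow> \<phi> i (\<lambda>z. \<Sum>j\<in>J. c j * g j z) = 0"
    let ?f = "\<lambda>z. \<Sum>j\<in>J. c j * g j z"
    have "?f z = 0" for z
    proof (rule Q_dofs_zero)
      show "?f \<in> Q_space k"
        unfolding Q by (intro fspan_lincomb fspan_base) auto
      fix s \<psi> assume s: "s \<in> {1..6}" and "\<psi> \<in> set (bfs_row k x s)"
      then obtain n where "n < length (bfs_row k x s)" "\<psi> = bfs_row k x s ! n"
        by (auto simp: in_set_conv_nth)
      with s zero[of "(s, Suc n)"] show "\<psi> ?f = 0"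
        by (auto simp: I_def \<phi>_def)
    qed
    then have "(\<Sum>(m, n)\<in>J. c (m, n) * monomial m n z) = 0" for z
      by (simp add: g_def case_prod_unfold)
    then show "\<forall>j\<in>J. c j = 0"
      using monomials_independent[of J "\<lambda>m n. c (m, n)"] by (auto simp: J_def)
  qed
  moreover have "(\<forall>i\<in>I. \<phi> i p = case_prod d i) \<longleftrightarrow>
      (\<forall>s\<in>{1..6}. \<forall>m\<in>{1..length (bfs_row k x s)}. (bfs_row k x s ! (m - 1)) p = d s m)" for p
    unfolding I_def \<phi>_def by simp
  ultimately show ?thesis
    unfolding Q by (simp only:)
qed

lemma bfs_basis_dual:
  shows "bfs_basis k x r n \<in> Q_space k"
    and "s \<in> {1..6} \<Longrightarrow> m \<in> {1..length (bfs_row k x s)} \<Longrightarrow>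
      (bfs_row k x s ! (m - 1)) (bfs_basis k x r n) = (if s = r \<and> m = n then 1 else 0)"
  using theI'[OF Q_unisolvent[of "\<lambda>s m. if s = r \<and> m = n then 1 else 0"], folded bfs_basis_def]
  by blast+

text \<open>All four functionals at \<open>x 2\<close>, \<open>dxy\<close> at \<open>x 3\<close>,
  \<open>dx\<close> at \<open>x 4\<close>, and the edge functionals spared in
  \<open>P_bubble_factor\<close>. The hypotheses of that lemma at vertices and edge nodes are
  exactly the other boundary functionals.\<close>

definition free_dofs :: "(nat \<times> nat) set" where
  "free_dofs = {1} \<times> {5, 6, 7, 8, 12, 14} \<union> {2} \<times> {1, 2, 3, 4, 6} \<union> {3} \<times> {2}"

lemma finite_free_dofs: "finite free_dofs"
  by (simp add: free_dofs_def)

lemma card_free_dofs: "card free_dofs = 12"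
proof -
  have eq: "free_dofs = {(1, 5), (1, 6), (1, 7), (1, 8), (1, 12), (1, 14),
      (2, 1), (2, 2), (2, 3), (2, 4), (2, 6), (3, 2)}"
    by (auto simp: free_dofs_def)
  show ?thesis unfolding eq by simp
qed

section \<open>Boundary and interior functionals on multiples of the bubble\<close>

lemma P_zero_dofs_bubble:
  assumes q: "q \<in> P_space k"
    and zero: "\<And>s m. s \<in> {1..5} \<Longrightarrow> m \<in> {1..length (bfs_row k x s)} \<Longrightarrow> (s, m) \<notin> free_dofs \<Longrightarrow>
      (bfs_row k x s ! (m - 1)) q = 0"
  obtains g where "g \<in> total_below (k - 7)" "\<And>s t. q (s, t) = bubble s t * g (s, t)"
proof -
  have vertex: "(vertex_dofs x ! (m - 1)) q = 0" if "m \<in> {1..16}" "(1, m) \<notin> free_dofs" for m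
    using zero[of 1 m] that by (simp add: bfs_row_def vertex_dofs_eq)
  note vertex = vertex[unfolded vertex_dofs_eq vertices free_dofs_def]
  have edge: "q z = 0" if "1 \<le> j" "j \<le> k - 3" "s \<in> {2..5}" "(s, 2 * j - 1) \<notin> free_dofs"
    "bfs_row k x s = edge_dofs k D u v" "edge_node k u v j = z" for s j D u v z
  proof -
    have "(bfs_row k x s ! (2 * j - 1 - 1)) q = 0"
      by (rule zero) (use that in auto)
    moreover have "2 * j - 1 - 1 = 2 * j - 2" by simp
    ultimately show ?thesis
      using edge_dofs_nth(1)[OF that(1,2), of D u v] that(5,6) by (simp only:)
  qed
  have normal: "D q z = 0" if "1 \<le> j" "j \<le> k - 3" "s \<in> {2..5}" "(s, 2 * j) \<notin> free_dofs"
    "bfs_row k x s = edge_dofs k D u v" "edge_node k u v j = z" for s j D u v z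
    using zero[of s "2 * j"] edge_dofs_nth(2)[OF that(1,2), of D u v] that by auto
  \<comment> \<open>Parity keeps the odd value positions apart from the even free positions 2, 4 and
    6.\<close>
  have odd: "2 * j - 1 \<noteq> 2 * i" if "1 \<le> j" for i j :: nat
    using that by presburger
  note odd = odd[of _ 1] odd[of _ 2] odd[of _ 3]
  note rows = bfs_row_def edge_node_eq[unfolded One_nat_def] free_dofs_def
  show ?thesis
  proof (rule P_bubble_factor[of q])
    show "q \<in> total_below (Suc k)" using q by (simp add: P_space_eq)
    show "q (a, b) = 0" "dx q (a, b) = 0" "dy q (a, b) = 0" "dxy q (a, b) = 0"
      using vertex[of 1] vertex[of 2] vertex[of 3] vertex[of 4] by simp_all
    show "q (a + h, b + h) = 0" "dx q (a + h, b + h) = 0" "dy q (a + h, b + h) = 0"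
      using vertex[of 9] vertex[of 10] vertex[of 11] by simp_all
    show "q (a, b + h) = 0" "dy q (a, b + h) = 0" "dxy q (a, b + h) = 0"
      using vertex[of 13] vertex[of 15] vertex[of 16] by simp_all
    show "q (node a j, b) = 0" if "3 \<le> j" "j \<le> k - 3" for j
      by (rule edge[of j 2]) (use that odd in \<open>auto simp: rows\<close>)
    show "dy q (node a j, b) = 0" if "4 \<le> j" "j \<le> k - 3" for j
      by (rule normal[of j 2]) (use that in \<open>auto simp: rows\<close>)
    show "q (a + h, node b j) = 0" if "1 \<le> j" "j \<le> k - 3" for j
      by (rule edge[of j 3]) (use that odd in \<open>auto simp: rows\<close>)
    show "dx q (a + h, node b j) = 0" if "2 \<le> j" "j \<le> k - 3" for j
      by (rule normal[of j 3]) (use that in \<open>auto simp: rows\<close>)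
    show "q (node a j, b + h) = 0" if "1 \<le> j" "j \<le> k - 3" for j
      by (rule edge[of j 4]) (use that in \<open>auto simp: rows\<close>)
    show "dy q (node a j, b + h) = 0" if "1 \<le> j" "j \<le> k - 3" for j
      by (rule normal[of j 4]) (use that in \<open>auto simp: rows\<close>)
    show "q (a, node b j) = 0" if "1 \<le> j" "j \<le> k - 3" for j
      by (rule edge[of j 5]) (use that in \<open>auto simp: rows\<close>)
    show "dx q (a, node b j) = 0" if "1 \<le> j" "j \<le> k - 3" for j
      by (rule normal[of j 5]) (use that in \<open>auto simp: rows\<close>)
  qed (rule that)
qed

lemma bubble_multiple_dofs:
  assumes g: "g \<in> total_below d" and f: "\<And>s t. f (s, t) = bubble s t * g (s, t)"
    and \<phi>: "s \<in> {1..5}" "\<phi> \<in> set (bfs_row k x s)"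
  shows "\<phi> f = 0"
proof -
  have "{1..5} = {1, 2, 3, 4, 5 :: nat}" by auto
  with \<phi>(1) consider "s = 1" | "s = 2" | "s = 3" | "s = 4" | "s = 5" by blast
  then show ?thesis
  proof cases
    case 1
    have "\<phi> \<in> set (vertex_dofs x)" using \<phi>(2) 1 by (simp add: bfs_row_def)
    then show ?thesis
      unfolding vertex_dofs_eq vertices
      using bubble_multiple_boundary[OF g f] by auto
  next
    case 2
    have "\<phi> \<in> set (edge_dofs k dy (x 1) (x 2))" using \<phi>(2) 2 by (simp add: bfs_row_def)
    then show ?thesis
      unfolding set_edge_dofs edge_node_eq using bubble_multiple_boundary[OF g f] by auto
  next
    case 3
    have "\<phi> \<in> set (edge_dofs k dx (x 2) (x 3))" using \<phi>(2) 3 by (simp add: bfs_row_def)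
    then show ?thesis
      unfolding set_edge_dofs edge_node_eq using bubble_multiple_boundary[OF g f] by auto
  next
    case 4
    have "\<phi> \<in> set (edge_dofs k dy (x 4) (x 3))" using \<phi>(2) 4 by (simp add: bfs_row_def)
    then show ?thesis
      unfolding set_edge_dofs edge_node_eq using bubble_multiple_boundary[OF g f] by auto
  next
    case 5
    have "\<phi> \<in> set (edge_dofs k dx (x 1) (x 4))" using \<phi>(2) 5 by (simp add: bfs_row_def)
    then show ?thesis
      unfolding set_edge_dofs edge_node_eq using bubble_multiple_boundary[OF g f] by auto
  qed
qed

text \<open>The bubble is nonzero at the interior nodes, so the conditions pass to \<open>g\<close>,
  whose k - 7 slice coefficients match a triangle with k - 7 columns.\<close>

lemma bubble_multiple_zero:
  assumes g: "g \<in> total_below (k - 7)" and f: "\<And>s t. f (s, t) = bubble s t * g (s, t)"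
    and zero: "\<And>\<phi>. \<phi> \<in> set (serendipity_inner_dofs k x) \<Longrightarrow> \<phi> f = 0"
  shows "f z = 0"
proof -
  define \<xi> where "\<xi> c i = c + h * real i / (real k - 2)" for c and i :: nat
  have inj: "inj_on (\<xi> c) J" for c J
    using h_pos k_minus_2_pos by (auto simp: inj_on_def \<xi>_def)
  \<comment> \<open>Each coordinate is bounded separately: the nodes stay inside the square even
    where \<open>k - 2 - i - j\<close> is negative.\<close>
  have \<xi>_bounds: "c < \<xi> c i" "\<xi> c i < c + h" if "1 \<le> i" "i \<le> k - 7" for c i
  proof -
    show "c < \<xi> c i"
      using that h_pos k_minus_2_pos by (simp add: \<xi>_def)
    have "h * real i < h * (real k - 2)"
      using that k_ge_6 h_pos by (intro mult_strict_left_mono) linarith+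
    then show "\<xi> c i < c + h"
      using k_minus_2_pos by (simp add: \<xi>_def pos_divide_less_eq)
  qed
  have "g z = 0" for z
  proof (rule total_below_zero_by_triangle[OF g inj inj])
    fix i j :: nat assume ij: "1 \<le> j" "j \<le> i" "i \<le> k - 7"
    then have "k > 7" by simp
    with ij have "(\<lambda>p. p (serendipity_node k x i j)) \<in> set (serendipity_inner_dofs k x)"
      by (auto simp: serendipity_inner_dofs_def intro!: bexI[of _ i] imageI)
    from zero[OF this] have "f (\<xi> a i, \<xi> b j) = 0"
      by (simp add: serendipity_node_eq \<xi>_def)
    moreover have "bubble (\<xi> a i) (\<xi> b j) \<noteq> 0"
      using \<xi>_bounds[of i a] \<xi>_bounds[of j b] ij by (simp add: bubble_def)
    ultimately show "g (\<xi> a i, \<xi> b j) = 0"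
      by (simp add: f)
  qed
  then show ?thesis using f by (cases z) simp
qed

section \<open>Generators of V_k and the final count\<close>

definition V_index :: "(nat \<times> nat + nat \<times> nat) set" where
  "V_index = Sigma {..k} (\<lambda>m. {..k - m}) <+> free_dofs"

text \<open>The sum type gives every generator its own coefficient, although independence of the two
  families is not yet known.\<close>

definition V_gen :: "nat \<times> nat + nat \<times> nat \<Rightarrow> plane_fun" where
  "V_gen = case_sum (\<lambda>(m, n). monomial m n) (\<lambda>(r, n). bfs_basis k x r n)"

lemma V_space_eq: "V_space k x = fspan (V_gen ` V_index)"
proof -
  let ?M = "{monomial m n |m n. m + n \<le> k}"
  let ?B = "(\<lambda>(r, n). bfs_basis k x r n) ` free_dofs"
  have M: "(\<lambda>(m, n). monomial m n) ` Sigma {..k} (\<lambda>m. {..k - m}) = ?M"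
  proof (intro equalityI subsetI)
    fix f assume "f \<in> ?M"
    then obtain m n where "f = monomial m n" "m + n \<le> k" by blast
    then show "f \<in> (\<lambda>(m, n). monomial m n) ` Sigma {..k} (\<lambda>m. {..k - m})"
      by (intro image_eqI[of _ _ "(m, n)"]) auto
  next
    fix f assume "f \<in> (\<lambda>(m, n). monomial m n) ` Sigma {..k} (\<lambda>m. {..k - m})"
    then obtain m n where "f = monomial m n" "m \<le> k" "n \<le> k - m" by auto
    moreover from this have "m + n \<le> k" by simp
    ultimately show "f \<in> ?M" by blast
  qed
  have "V_gen ` V_index = ?M \<union> ?B"
    unfolding M[symmetric] V_index_def V_gen_def Plus_def image_Un image_image by simp
  moreover have "fspan (fspan ?M \<union> ?B) = fspan (?M \<union> ?B)"
  proof
    show "fspan (fspan ?M \<union> ?B) \<subseteq> fspan (?M \<union> ?B)"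
      using fspan_mono[of ?M "?M \<union> ?B"] fspan_base[of _ "?M \<union> ?B"]
      by (intro fspan_minimal subspace_fspan) blast
    show "fspan (?M \<union> ?B) \<subseteq> fspan (fspan ?M \<union> ?B)"
      using fspan_base[of _ ?M] by (intro fspan_mono) blast
  qed
  moreover have "?B = bfs_basis k x 1 ` {5, 6, 7, 8, 12, 14} \<union> bfs_basis k x 2 ` {1, 2, 3, 4, 6}
      \<union> bfs_basis k x 3 ` {2}"
    unfolding free_dofs_def image_Un by auto
  ultimately show ?thesis
    by (simp only: V_space_def P_space_def Un_assoc)
qed

lemma card_V_index: "card V_index = length (V_dofs k x)"
proof -
  have "2 * (\<Sum>m\<le>n. Suc (n - m)) = (n + 1) * (n + 2)" for n :: nat
  proof (induction n)
    case (Suc n)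
    have "(\<Sum>m\<le>Suc n. Suc (Suc n - m)) = Suc (Suc n) + (\<Sum>m\<le>n. Suc (n - m))"
      by (subst sum.atMost_Suc_shift) simp
    with Suc show ?case by simp
  qed simp
  then have "2 * card V_index = (k + 1) * (k + 2) + 24"
    by (simp add: V_index_def card_Plus finite_free_dofs card_free_dofs)
  moreover have "2 * length (V_dofs k x) = 32 + 16 * (k - 3) + (k - 7) * (k - 6)"
    using length_serendipity_inner_dofs[of k x] by (simp add: V_dofs_def vertex_dofs_eq)
  moreover obtain n where n: "k = n + 6"
    using k_ge_6 by (metis add.commute le_Suc_ex)
  have "(k + 1) * (k + 2) + 24 = 32 + 16 * (k - 3) + (k - 7) * (k - 6)"
    \<comment> \<open>The case \<open>n = 0\<close> is k = 6, where \<open>k - 7\<close> truncates;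
      the product is still right because \<open>k - 6\<close> vanishes.\<close>
    unfolding n by (cases n) (auto simp: algebra_simps)
  ultimately show ?thesis by simp
qed

lemma V_unisolvent:
  "\<exists>!p. p \<in> V_space k x \<and> (\<forall>n<length (V_dofs k x). (V_dofs k x ! n) p = d n)"
proof -
  let ?M = "Sigma {..k} (\<lambda>m. {..k - m})"
  have fin: "finite V_index"
    by (simp add: V_index_def finite_free_dofs)
  have Q: "Q_space k = fspan {monomial m n |m n. m \<le> k \<and> n \<le> k}"
    by (simp add: Q_space_def)
  have mono: "monomial m n \<in> P_space k" if "(m, n) \<in> ?M" for m n
    using that by (auto simp: P_space_eq intro!: monomial_in_total_below)
  have P_subset: "P_space k \<subseteq> Q_space k"
    by (simp add: P_space_eq Q_space_eq total_below_subset)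
  have gen: "V_gen j \<in> Q_space k" if "j \<in> V_index" for j
    using that mono P_subset bfs_basis_dual(1) by (auto simp: V_index_def V_gen_def)
  have "\<exists>!p. p \<in> fspan (V_gen ` V_index) \<and>
      (\<forall>n\<in>{..<length (V_dofs k x)}. (V_dofs k x ! n) p = d n)"
  proof (rule unisolvent_fspan)
    show "finite {..<length (V_dofs k x)}" "finite V_index" using fin by simp_all
    show "card {..<length (V_dofs k x)} = card V_index" by (simp add: card_V_index)
    show "V_gen j \<in> fspan {monomial m n |m n. m \<le> k \<and> n \<le> k}" if "j \<in> V_index" for j
      using gen[OF that] by (simp add: Q)
    show "linear_dof_on (fspan {monomial m n |m n. m \<le> k \<and> n \<le> k}) (V_dofs k x ! n)"
      if "n \<in> {..<length (V_dofs k x)}" for n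
      using that V_dofs_linear[of "V_dofs k x ! n" k x] by (simp add: Q)
  next
    fix c assume zero: "\<And>n. n \<in> {..<length (V_dofs k x)} \<Longrightarrow>
        (V_dofs k x ! n) (\<lambda>z. \<Sum>j\<in>V_index. c j * V_gen j z) = 0"
    define q where "q = (\<lambda>z. \<Sum>(m, n)\<in>?M. c (Inl (m, n)) * monomial m n z)"
    define r where "r = (\<lambda>z. \<Sum>i\<in>free_dofs. c (Inr i) * V_gen (Inr i) z)"
    have split: "(\<lambda>z. \<Sum>j\<in>V_index. c j * V_gen j z) = (\<lambda>z. q z + r z)"
      by (simp add: V_index_def q_def r_def V_gen_def sum.Plus finite_free_dofs case_prod_unfold)
    have q: "q \<in> P_space k"
      unfolding q_def case_prod_unfold P_space_def
      using mono by (intro fspan_lincomb) (auto simp: P_space_def)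
    have basis: "V_gen (Inr i) \<in> Q_space k" if "i \<in> free_dofs" for i
      using gen that by (auto simp: V_index_def)
    have r: "r \<in> Q_space k"
      unfolding r_def Q using basis by (intro fspan_lincomb) (simp add: Q)
    have zero': "\<phi> (\<lambda>z. q z + r z) = 0" if "\<phi> \<in> set (V_dofs k x)" for \<phi>
      using that zero unfolding split by (auto simp: in_set_conv_nth)
    \<comment> \<open>By duality a boundary functional applied to \<open>r\<close> returns its own
      coefficient if it is free and zero otherwise.\<close>
    have dof: "(bfs_row k x s ! (m - 1)) q + (if (s, m) \<in> free_dofs then c (Inr (s, m)) else 0) = 0"
      if s: "s \<in> {1..5}" and m: "m \<in> {1..length (bfs_row k x s)}" for s m
    proof -
      let ?\<phi> = "bfs_row k x s ! (m - 1)"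
      have in_row: "?\<phi> \<in> set (bfs_row k x s)" using m by auto
      note lin = bfs_row_linear[OF in_row]
      have "?\<phi> r = (\<Sum>i\<in>free_dofs. c (Inr i) * ?\<phi> (V_gen (Inr i)))"
        unfolding r_def using lin basis unfolding Q by (rule linear_dof_on_lincomb)
      also have "\<dots> = (\<Sum>i\<in>free_dofs. if (s, m) = i then c (Inr i) else 0)"
      proof (rule sum.cong)
        fix i assume "i \<in> free_dofs"
        show "c (Inr i) * ?\<phi> (V_gen (Inr i)) = (if (s, m) = i then c (Inr i) else 0)"
          using bfs_basis_dual(2)[of s m "fst i" "snd i"] s m
          by (auto simp: V_gen_def case_prod_unfold prod_eq_iff)
      qed simp
      also have "\<dots> = (if (s, m) \<in> free_dofs then c (Inr (s, m)) else 0)"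
        by (simp add: finite_free_dofs)
      finally have "?\<phi> r = (if (s, m) \<in> free_dofs then c (Inr (s, m)) else 0)" .
      moreover have "?\<phi> (\<lambda>z. q z + r z) = ?\<phi> q + ?\<phi> r"
        using lin q r P_subset by (intro linear_dof_on_add) auto
      moreover have "?\<phi> (\<lambda>z. q z + r z) = 0"
        using in_row s by (intro zero') (auto simp: set_V_dofs)
      ultimately show ?thesis by simp
    qed
    obtain g where g: "g \<in> total_below (k - 7)" "\<And>s t. q (s, t) = bubble s t * g (s, t)"
      by (rule P_zero_dofs_bubble[OF q]) (use dof in force)+
    have cr: "c (Inr i) = 0" if "i \<in> free_dofs" for i
    proof -
      obtain s m where i: "i = (s, m)" by (cases i)
      have s: "s \<in> {1..5}" and m: "m \<in> {1..length (bfs_row k x s)}"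
        using that k_ge_6 by (auto simp: i free_dofs_def bfs_row_def vertex_dofs_eq)
      have "(bfs_row k x s ! (m - 1)) q = 0"
        using m by (intro bubble_multiple_dofs[OF g s]) auto
      with dof[OF s m] that show ?thesis by (simp add: i)
    qed
    \<comment> \<open>The interior functionals are usable only now: duality does not give their
      values on \<open>r\<close>.\<close>
    have "r = (\<lambda>z. 0)" by (simp add: r_def cr)
    then have "q z = 0" for z
      using zero' by (intro bubble_multiple_zero[OF g]) (simp add: set_V_dofs)
    then have "c (Inl (m, n)) = 0" if "(m, n) \<in> ?M" for m n
      using monomials_independent[of ?M "\<lambda>m n. c (Inl (m, n))", OF _ _ that] by (simp add: q_def)
    with cr show "\<forall>j\<in>V_index. c j = 0"
      by (auto simp: V_index_def)
  qed
  then show ?thesis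
    by (simp add: V_space_eq Ball_def)
qed

end

theorem lemma4p1:
  fixes k :: nat and T :: "(real \<times> real) set" and x :: "nat \<Rightarrow> real \<times> real"
  assumes "k \<ge> 6" and "square_vertices T x"
  shows "\<forall>c :: nat \<Rightarrow> real. \<exists>!p. p \<in> V_space k x \<and>
           (\<forall>n < length (V_dofs k x). (V_dofs k x ! n) p = c n)"
proof -
  obtain a b h where "h > 0" "x 1 = (a, b)" "x 2 = (a + h, b)" "x 3 = (a + h, b + h)"
    "x 4 = (a, b + h)"
    using assms(2) unfolding square_vertices_def by blast
  then interpret bfs_square k a b h x
    using assms(1) by unfold_locales
  show ?thesis
    using V_unisolvent by blast
qed

end
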